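(* Let $w\in S_n$ and let $P$ be an EG-pipedream of $w$. Then there is a leaf of the Edelman-Greene tree of $w$ whose label is $P$.
   Context: Permutations are in one-line notation; $\ell(u)$ = number of inversions; $ut_{a,b}$ swaps the entries in positions $a,b$; $I(u,k)=\{i<k:\ell(ut_{i,k})=\ell(u)+1\}$; $1\times u=1(u_1+1)\cdots(u_n+1)$; $\Phi(u,k)=\{ut_{i,k}:i\in I(u,k)\}$ if $I(u,k)\neq\emptyset$, else $\Phi(1\times u,k+1)$. A permutation is dominant if it avoids $132$. For non-dominant $u$: $p=\max\{t:\exists\, i<t<j,\ u_i<u_j<u_t\}$, $q=\max\{j: j>p,\ u_j<u_p,\ \exists\, i<p,\ u_i<u_j\}$. Modified Lascoux-Sch\"utzenberger tree of $w$: root $w$; dominant nodes are leaves; a non-dominant node $u$ has children the elements of $\Phi(ut_{p,q},p)$. Bumpless pipedreams of $w$ on the $n\times n$ grid (boxes $(r,c)$, row from top, column from left): $n$ pipes, pipe $k$ entering the south boundary in column $k$ and exiting the east boundary in row $w^{-1}(k)$, moving only north/east, no shared steps, no double crossings, each box empty, NW elbow (enter west, exit north), SE elbow (enter south, exit east), horizontal, vertical or crossing. An EG-pipedream of $w$ is a bumpless pipedream of $w$ whose empty boxes form a Young diagram of a partition at the northwest corner. $D(w)$ is the Rothe pipedream: SE elbows at $(k,w_k)$ with pipes going right and down from them. Droop: for an SE elbow $e$ strictly northwest of an empty box $t$, with $R$ the rectangle with corners $e$, $t$ and $L$ the pipe through $e$, when $L$ runs along the westmost column and northmost row of $R$, $R$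 has no other elbow, and the result is a bumpless pipedream, the droop reroutes $L$ along the southmost row and eastmost column of $R$. Edelman-Greene tree of $w$: for each root-to-leaf path $w=w^{(0)}\to\cdots\to w^{(m)}$ in the modified Lascoux-Sch\"utzenberger tree, with $p_j,q_j$ the indices of $w^{(j)}$ and $i_j\in I(w^{(j)}t_{p_j,q_j},p_j)$ with $w^{(j+1)}=w^{(j)}t_{p_j,q_j}t_{i_j,p_j}$, set $P_0=D(w)$ and let $P_{j+1}$ be obtained from $P_j$ by the droop with respect to the empty box $(p_j,w^{(j)}_{q_j})$ and the SE elbow $(i_j,w^{(j)}_{i_j})$ (these droops are always allowed). The Edelman-Greene tree is the tree of the same shape in which the node corresponding to $w^{(j)}$ on this path is labeled $P_j$. *)

theory Defs
  imports "HOL-Combinatorics.Permutations" "HOL-Library.Sublist"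
begin

section \<open>The modified Lascoux--Schuetzenberger tree\<close>

text \<open>
  An element of the symmetric group on n letters is a function u with u permutes {1..n}; it fixes
  0 and every j > n. The value u j is the j-th entry of the one-line notation. Position 0 is
  excluded below, and the fixed points beyond n are larger than all the entries before them, so
  they take part in no inversion, no 132 pattern and no index p or q; none of these notions
  depends on n.
\<close>

definition inversions :: "(nat \<Rightarrow> nat) \<Rightarrow> (nat \<times> nat) set" where
  "inversions u = {(i, j). 1 \<le> i \<and> i < j \<and> u j < u i}"

definition perm_length :: "(nat \<Rightarrow> nat) \<Rightarrow> nat" where
  "perm_length u = card (inversions u)"

definition swap_pos :: "(nat \<Rightarrow> nat) \<Rightarrow> nat \<Rightarrow> nat \<Rightarrow> (nat \<Rightarrow> nat)" where
  "swap_pos u a b = u \<circ> transpose a b"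

definition I_set :: "(nat \<Rightarrow> nat) \<Rightarrow> nat \<Rightarrow> nat set" where
  "I_set u k = {i. 1 \<le> i \<and> i < k \<and> perm_length (swap_pos u i k) = perm_length u + 1}"

definition one_times :: "(nat \<Rightarrow> nat) \<Rightarrow> (nat \<Rightarrow> nat)" where
  "one_times u = (\<lambda>j. if j \<le> 1 then j else u (j - 1) + 1)"

inductive in_Phi :: "(nat \<Rightarrow> nat) \<Rightarrow> nat \<Rightarrow> (nat \<Rightarrow> nat) \<Rightarrow> bool" where
  swap: "i \<in> I_set u k \<Longrightarrow> in_Phi u k (swap_pos u i k)"
| shift: "I_set u k = {} \<Longrightarrow> in_Phi (one_times u) (k + 1) v \<Longrightarrow> in_Phi u k v"

definition Phi :: "(nat \<Rightarrow> nat) \<Rightarrow> nat \<Rightarrow> (nat \<Rightarrow> nat) set" where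
  "Phi u k = {v. in_Phi u k v}"

definition dominant :: "(nat \<Rightarrow> nat) \<Rightarrow> bool" where
  "dominant u \<longleftrightarrow> \<not> (\<exists>i t j. 1 \<le> i \<and> i < t \<and> t < j \<and> u i < u j \<and> u j < u t)"

definition p_index :: "(nat \<Rightarrow> nat) \<Rightarrow> nat" where
  "p_index u = Max {t. \<exists>i j. 1 \<le> i \<and> i < t \<and> t < j \<and> u i < u j \<and> u j < u t}"

definition q_index :: "(nat \<Rightarrow> nat) \<Rightarrow> nat" where
  "q_index u = Max {j. p_index u < j \<and> u j < u (p_index u) \<and>
                       (\<exists>i. 1 \<le> i \<and> i < p_index u \<and> u i < u j)}"

definition LS_children :: "(nat \<Rightarrow> nat) \<Rightarrow> (nat \<Rightarrow> nat) set" where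
  "LS_children u =
     (if dominant u then {} else Phi (swap_pos u (p_index u) (q_index u)) (p_index u))"

text \<open>
  A node of the tree is encoded by the list of permutations on the path from the root to it, since
  the same permutation may label several nodes. The permutation at the node \<open>ws\<close> is \<open>last ws\<close>,
  and the children of \<open>ws\<close> are the nodes of the form \<open>ws @ [v]\<close>.
\<close>

inductive_set LS_tree :: "(nat \<Rightarrow> nat) \<Rightarrow> (nat \<Rightarrow> nat) list set" for w where
  root: "[w] \<in> LS_tree w"
| child: "ws \<in> LS_tree w \<Longrightarrow> v \<in> LS_children (last ws) \<Longrightarrow> ws @ [v] \<in> LS_tree w"

section \<open>Bumpless pipedreams\<close>

text \<open>
  Boxes are pairs (row, column), with rows numbered from the top. A pipe is the list of boxes it
  visits, together with two positions just outside the grid: it starts at (n + 1, k), below the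
  south boundary, and ends at (r, n + 1), beyond the east boundary.
\<close>

type_synonym box = "nat \<times> nat"
type_synonym pipe = "box list"
type_synonym pipedream = "nat \<Rightarrow> pipe"

definition grid :: "nat \<Rightarrow> box set" where
  "grid n = {1..n} \<times> {1..n}"

definition unit_step :: "box \<Rightarrow> box \<Rightarrow> bool" where
  "unit_step x y \<longleftrightarrow> (fst x = fst y + 1 \<and> snd y = snd x) \<or> (fst y = fst x \<and> snd y = snd x + 1)"

definition is_pipe :: "nat \<Rightarrow> nat \<Rightarrow> nat \<Rightarrow> pipe \<Rightarrow> bool" where
  "is_pipe n k r L \<longleftrightarrow>
     (\<exists>M. L = (n + 1, k) # M @ [(r, n + 1)] \<and> set M \<subseteq> grid n) \<and> successively unit_step L"

definition horizontal_at :: "pipe \<Rightarrow> box \<Rightarrow> bool" where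
  "horizontal_at L x \<longleftrightarrow> (case x of (r, c) \<Rightarrow> sublist [(r, c - 1), (r, c), (r, c + 1)] L)"

definition vertical_at :: "pipe \<Rightarrow> box \<Rightarrow> bool" where
  "vertical_at L x \<longleftrightarrow> (case x of (r, c) \<Rightarrow> sublist [(r + 1, c), (r, c), (r - 1, c)] L)"

definition SE_elbow_at :: "pipe \<Rightarrow> box \<Rightarrow> bool" where
  "SE_elbow_at L x \<longleftrightarrow> (case x of (r, c) \<Rightarrow> sublist [(r + 1, c), (r, c), (r, c + 1)] L)"

definition NW_elbow_at :: "pipe \<Rightarrow> box \<Rightarrow> bool" where
  "NW_elbow_at L x \<longleftrightarrow> (case x of (r, c) \<Rightarrow> sublist [(r, c - 1), (r, c), (r - 1, c)] L)"

text \<open>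
  A box visited by a single pipe is automatically an elbow, horizontal or vertical. A box visited
  by two pipes has to be a crossing; as at most one of the pipes in a box is horizontal and at most
  one is vertical, no box is visited by three pipes. The value of P outside {1..n} is fixed, so
  that two bumpless pipedreams are equal iff all their pipes are.
\<close>

definition bumpless_pipedream :: "nat \<Rightarrow> (nat \<Rightarrow> nat) \<Rightarrow> pipedream \<Rightarrow> bool" where
  "bumpless_pipedream n w P \<longleftrightarrow>
     (\<forall>k\<in>{1..n}. is_pipe n k (inv w k) (P k)) \<and>
     (\<forall>k. k \<notin> {1..n} \<longrightarrow> P k = []) \<and>
     (\<forall>k\<in>{1..n}. \<forall>l\<in>{1..n}. k \<noteq> l \<longrightarrow>
        \<comment> \<open>no shared steps\<close>
        \<not> (\<exists>x y. sublist [x, y] (P k) \<and> sublist [x, y] (P l)) \<and>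
        \<comment> \<open>boxes visited by two pipes are crossings\<close>
        (\<forall>x \<in> set (P k) \<inter> set (P l).
           (horizontal_at (P k) x \<and> vertical_at (P l) x) \<or>
           (vertical_at (P k) x \<and> horizontal_at (P l) x)) \<and>
        \<comment> \<open>no double crossings\<close>
        (\<forall>x \<in> set (P k) \<inter> set (P l). \<forall>y \<in> set (P k) \<inter> set (P l). x = y))"

definition empty_boxes :: "nat \<Rightarrow> pipedream \<Rightarrow> box set" where
  "empty_boxes n P = {x \<in> grid n. \<forall>k\<in>{1..n}. x \<notin> set (P k)}"

text \<open>
  The parts of the partition are lam 1, lam 2, and so on (lam 0 is irrelevant); they are eventually
  0 because the set of empty boxes is finite.
\<close>

definition EG_pipedream :: "nat \<Rightarrow> (nat \<Rightarrow> nat) \<Rightarrow> pipedream \<Rightarrow> bool" where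
  "EG_pipedream n w P \<longleftrightarrow> bumpless_pipedream n w P \<and>
     (\<exists>lam :: nat \<Rightarrow> nat. antimono lam \<and>
        empty_boxes n P = {(r, c). 1 \<le> r \<and> 1 \<le> c \<and> c \<le> lam r})"

text \<open>\<open>north_run a b c\<close> goes up column c from row a to row b \<open>\<le>\<close> a;
  \<open>east_run r c d\<close> goes right along row r from column c to column d \<open>\<ge>\<close> c.\<close>

definition north_run :: "nat \<Rightarrow> nat \<Rightarrow> nat \<Rightarrow> box list" where
  "north_run a b c = map (\<lambda>i. (i, c)) (rev [b..<Suc a])"

definition east_run :: "nat \<Rightarrow> nat \<Rightarrow> nat \<Rightarrow> box list" where
  "east_run r c d = map (\<lambda>j. (r, j)) [c..<Suc d]"

definition Rothe_pipedream :: "nat \<Rightarrow> (nat \<Rightarrow> nat) \<Rightarrow> pipedream" where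
  "Rothe_pipedream n w = (\<lambda>k. if k \<in> {1..n}
     then north_run (n + 1) (inv w k) k @ east_run (inv w k) (k + 1) (n + 1) else [])"

definition droop :: "nat \<Rightarrow> (nat \<Rightarrow> nat) \<Rightarrow> pipedream \<Rightarrow> box \<Rightarrow> box \<Rightarrow> pipedream \<Rightarrow> bool" where
  "droop n w P e t P' \<longleftrightarrow>
     (case e of (a, b) \<Rightarrow> case t of (c, d) \<Rightarrow>
        a < c \<and> b < d \<and> (c, d) \<in> empty_boxes n P \<and>
        (\<exists>k\<in>{1..n}. \<exists>xs ys.
           SE_elbow_at (P k) (a, b) \<and>
           P k = xs @ (north_run c a b @ east_run a (b + 1) d) @ ys \<and>
           P' = P(k := xs @ (east_run c b d @ north_run (c - 1) a d) @ ys)) \<and>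
        (\<forall>x \<in> {a..c} \<times> {b..d} - {(a, b)}. \<forall>l\<in>{1..n}.
           \<not> SE_elbow_at (P l) x \<and> \<not> NW_elbow_at (P l) x) \<and>
        bumpless_pipedream n w P')"

section \<open>The Edelman--Greene tree\<close>

text \<open>
  An element (ws, P) is the node corresponding to the node \<open>ws\<close> of \<^term>\<open>LS_tree w\<close>, labelled P.
\<close>

inductive_set EG_tree :: "nat \<Rightarrow> (nat \<Rightarrow> nat) \<Rightarrow> ((nat \<Rightarrow> nat) list \<times> pipedream) set"
  for n w where
  root: "([w], Rothe_pipedream n w) \<in> EG_tree n w"
| child: "(ws, P) \<in> EG_tree n w \<Longrightarrow> u = last ws \<Longrightarrow> p = p_index u \<Longrightarrow> q = q_index u \<Longrightarrow>
    i \<in> I_set (swap_pos u p q) p \<Longrightarrow> v = swap_pos (swap_pos u p q) i p \<Longrightarrow>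
    ws @ [v] \<in> LS_tree w \<Longrightarrow> droop n w P (i, u i) (p, u q) P' \<Longrightarrow>
    (ws @ [v], P') \<in> EG_tree n w"

text \<open>
  Having the same shape as \<^term>\<open>LS_tree w\<close>, the Edelman--Greene tree has a leaf exactly where
  \<^term>\<open>LS_tree w\<close> has no further child.
\<close>

definition EG_leaf :: "nat \<Rightarrow> (nat \<Rightarrow> nat) \<Rightarrow> (nat \<Rightarrow> nat) list \<times> pipedream \<Rightarrow> bool" where
  "EG_leaf n w x \<longleftrightarrow> x \<in> EG_tree n w \<and> \<not> (\<exists>v. fst x @ [v] \<in> LS_tree w)"

end

theory Submission
  imports Defs
begin

text \<open>
  In terms of the target P, the pipedreams met on the way from the Rothe pipedream to P are
  truncations of P: such a truncation agrees with P in the rows below row p and on the part of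
  row p to the right of an SE elbow in column c, and above that every pipe goes straight up to its
  exit row. If P has another SE elbow to the left of c in row p, passing to that elbow is a
  droop. Because the empty boxes of P are left-justified in their rows, it is exactly the droop
  prescribed by the indices p and q of the current node, and the condition on i holds because two
  pipes of P cross at most once. Left-justification also ensures that no 132 pattern has its
  largest entry beyond position p; so when row 1 is done the node is dominant and its label is P.
\<close>

section \<open>Pipes as column functions\<close>

text \<open>The obstacle is that a truncation shows the permutation \<open>u\<close> of its node
  only at the positions up to p: for r < p, \<open>u r\<close> is the column in which the pipe
  exiting in row r goes straight up. Beyond p only the set of remaining values is known. So q is
  located by its value: the next turn in row p ends in a box (p, d) that is empty in the truncation,
  hence d sits beyond p; and without 132 patterns beyond p, the last admissible position carries the
  largest admissible value. Left-justification then only has to exclude values strictly between d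
  and c. In terms of column functions, crossing at most once says that an inverted pair of pipes
  stays inverted. Hence in such a pair the larger label exits in the higher row, which governs both
  the straight parts of the truncations and the condition on i. Passing from row p + 1 to row p
  needs no droop: pipe \<open>w p\<close> runs along row p from column \<open>u p\<close> to the
  border, so every pipe further right is straight there, and the last truncation in row p + 1 is
  also the first one in row p.\<close>

lemma unit_step_content:
  assumes "successively unit_step L" "i < length L"
  shows "int (snd (L ! i)) - int (fst (L ! i)) = int (snd (hd L)) - int (fst (hd L)) + int i"
  using assms
proof (induction L arbitrary: i rule: induct_list012)
  case (3 x y zs)
  then show ?case
    by (cases i) (force simp: unit_step_def)+
qed auto

text \<open>Column minus row grows by one at each step, so it fixes the position of a box in a path.
  Boxes of \<open>xs\<close> have consecutive values and therefore consecutive positions in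
  \<open>L\<close>. All tile conditions thereby reduce to membership of boxes.\<close>

lemma sublist_unit_step_iff:
  assumes L: "successively unit_step L"
  shows "sublist xs L \<longleftrightarrow> set xs \<subseteq> set L \<and> successively unit_step xs"
proof
  assume "sublist xs L"
  then obtain ps ss where "L = ps @ xs @ ss"
    by (auto simp: sublist_def)
  with L show "set xs \<subseteq> set L \<and> successively unit_step xs"
    by (auto simp: successively_append_iff)
next
  assume xs: "set xs \<subseteq> set L \<and> successively unit_step xs"
  show "sublist xs L"
  proof (cases "xs = []")
    case False
    then have hd: "hd xs = xs ! 0" and "xs ! 0 \<in> set L"
      using xs by (auto simp: hd_conv_nth)
    then obtain a where a: "a < length L" "L ! a = xs ! 0"
      by (metis in_set_conv_nth)
    have nth: "a + j < length L \<and> L ! (a + j) = xs ! j" if "j < length xs" for j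
    proof -
      have "xs ! j \<in> set L"
        using that xs by auto
      then obtain b where b: "b < length L" "L ! b = xs ! j"
        by (metis in_set_conv_nth)
      have "b = a + j"
        using unit_step_content[OF L a(1)] unit_step_content[OF L b(1)]
          unit_step_content[OF conjunct2[OF xs] that] a(2) b(2) hd by simp
      with b show ?thesis by simp
    qed
    from nth[of "length xs - 1"] False have "a + length xs \<le> length L"
      by (cases xs) auto
    with nth have "take (length xs) (drop a L) = xs"
      by (intro nth_equalityI) auto
    then have "L = take a L @ xs @ drop (length xs) (drop a L)"
      by (metis append_take_drop_id)
    then show ?thesis
      by (metis sublist_appendI)
  qed simp
qed

context
  fixes L :: pipe
  assumes L: "successively unit_step L"
begin

text \<open>The bound \<open>1 <= c\<close> is forced by truncated subtraction: for c = 0 the boxes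
  in columns c - 1 and c would coincide, and no unit step leads from a box to itself.\<close>

lemma horizontal_at_iff:
  "horizontal_at L (r, c) \<longleftrightarrow> 1 \<le> c \<and> {(r, c - 1), (r, c), (r, c + 1)} \<subseteq> set L"
  unfolding horizontal_at_def prod.case sublist_unit_step_iff[OF L] by (auto simp: unit_step_def)

lemma vertical_at_iff:
  "vertical_at L (r, c) \<longleftrightarrow> 1 \<le> r \<and> {(r + 1, c), (r, c), (r - 1, c)} \<subseteq> set L"
  unfolding vertical_at_def prod.case sublist_unit_step_iff[OF L] by (auto simp: unit_step_def)

lemma SE_elbow_at_iff:
  "SE_elbow_at L (r, c) \<longleftrightarrow> {(r + 1, c), (r, c), (r, c + 1)} \<subseteq> set L"
  unfolding SE_elbow_at_def prod.case sublist_unit_step_iff[OF L] by (auto simp: unit_step_def)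

lemma NW_elbow_at_iff:
  "NW_elbow_at L (r, c) \<longleftrightarrow> 1 \<le> r \<and> 1 \<le> c \<and> {(r, c - 1), (r, c), (r - 1, c)} \<subseteq> set L"
  unfolding NW_elbow_at_def prod.case sublist_unit_step_iff[OF L] by (auto simp: unit_step_def)

end

section \<open>Lattice paths assembled row by row\<close>

definition rows :: "nat \<Rightarrow> nat \<Rightarrow> (nat \<Rightarrow> nat) \<Rightarrow> box list" where
  "rows R s f = concat (map (\<lambda>r. east_run r (f (Suc r)) (f r)) (rev [R..<s]))"

definition pipe_of :: "nat \<Rightarrow> nat \<Rightarrow> (nat \<Rightarrow> nat) \<Rightarrow> pipe" where
  "pipe_of n R f = (n + 1, f (n + 1)) # rows R (n + 1) f"

lemma rows_Suc: "R \<le> s \<Longrightarrow> rows R (Suc s) f = east_run s (f (Suc s)) (f s) @ rows R s f"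
  by (simp add: rows_def)

lemma rows_empty [simp]: "rows R R f = []"
  by (simp add: rows_def)

lemma rows_append: "R \<le> s \<Longrightarrow> s \<le> t \<Longrightarrow> rows R t f = rows s t f @ rows R s f"
  unfolding rows_def using upt_add_eq_append[of R s "t - s"] by simp

lemma rows_cong: "(\<And>r. R \<le> r \<Longrightarrow> r \<le> s \<Longrightarrow> f r = g r) \<Longrightarrow> rows R s f = rows R s g"
  unfolding rows_def by (intro arg_cong[where f = concat] map_cong) auto

lemma pipe_of_cong: "R \<le> n + 1 \<Longrightarrow> (\<And>r. R \<le> r \<Longrightarrow> r \<le> n + 1 \<Longrightarrow> f r = g r) \<Longrightarrow> pipe_of n R f = pipe_of n R g"
  unfolding pipe_of_def by (auto intro: rows_cong)

lemma set_rows: "(r, c) \<in> set (rows R s f) \<longleftrightarrow> R \<le> r \<and> r < s \<and> f (Suc r) \<le> c \<and> c \<le> f r"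
  by (auto simp: rows_def east_run_def image_iff)

lemma set_pipe_of:
  "(r, c) \<in> set (pipe_of n R f) \<longleftrightarrow>
     r = n + 1 \<and> c = f (n + 1) \<or> R \<le> r \<and> r \<le> n \<and> f (Suc r) \<le> c \<and> c \<le> f r"
  by (auto simp: pipe_of_def set_rows)

lemma east_run_Cons: "c \<le> d \<Longrightarrow> east_run r c d = (r, c) # east_run r (Suc c) d"
  by (simp add: east_run_def upt_rec[of c])

lemma east_run_snoc: "c \<le> Suc d \<Longrightarrow> east_run r c (Suc d) = east_run r c d @ [(r, Suc d)]"
  by (simp add: east_run_def)

lemma east_run_append:
  "c \<le> Suc d \<Longrightarrow> d \<le> e \<Longrightarrow> east_run r c e = east_run r c d @ east_run r (Suc d) e"
  unfolding east_run_def using upt_add_eq_append[of c "Suc d" "e - d"] by simp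

lemma successively_east_run: "successively unit_step (east_run r c d)"
  unfolding east_run_def successively_map
  by (induction d) (auto simp: successively_append_iff unit_step_def)

lemma successively_rows:
  assumes "\<And>r. R \<le> r \<Longrightarrow> r < s \<Longrightarrow> f (Suc r) \<le> f r" "R \<le> s"
  shows "successively unit_step ((s, f s) # rows R s f)"
  using assms(2,1)
proof (induction s rule: dec_induct)
  case (step s)
  have le: "f (Suc s) \<le> f s" and "successively unit_step ((s, f s) # rows R s f)"
    using step by auto
  moreover have "(Suc s, f (Suc s)) # rows R (Suc s) f =
      ((Suc s, f (Suc s)) # east_run s (f (Suc s)) (f s)) @ rows R s f" (is "_ = ?L @ _")
    using step by (simp add: rows_Suc)
  moreover have "successively unit_step ?L"
    using le successively_east_run[of s "f (Suc s)" "f s"]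
    by (simp add: east_run_Cons unit_step_def)
  moreover have "last ?L = (s, f s)"
    using le by (auto simp: east_run_def last_map)
  ultimately show ?case
    by (simp only: successively_append_iff successively_Cons) auto
qed simp

lemma successively_pipe_of:
  assumes "\<And>r. R \<le> r \<Longrightarrow> r \<le> n \<Longrightarrow> f (Suc r) \<le> f r" "R \<le> n + 1"
  shows "successively unit_step (pipe_of n R f)"
  unfolding pipe_of_def using assms by (intro successively_rows) auto

text \<open>Induction on the path moves its start, possibly into the middle of a horizontal run;
  hence the run in the starting row is kept apart from \<open>rows\<close>. An upward first step
  opens a new row, an eastward one extends the current run.\<close>

lemma unit_path_columns:
  assumes "successively unit_step L" "L \<noteq> []" "hd L = (s, c)" "last L = (R, d)"
  shows "\<exists>f. R \<le> s \<and> f R = d \<and> c \<le> f s \<and> L = east_run s c (f s) @ rows R s f \<and>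
    (\<forall>r. R \<le> r \<and> r < s \<longrightarrow> f (Suc r) \<le> f r)"
  using assms
proof (induction L arbitrary: s c rule: induct_list012)
  case (2 x)
  then show ?case
    by (intro exI[of _ "\<lambda>_. d"]) (auto simp: east_run_def)
next
  case (3 x y zs)
  obtain s' c' where y: "y = (s', c')" by fastforce
  have x: "x = (s, c)" using "3.prems" by simp
  obtain f where f: "R \<le> s'" "f R = d" "c' \<le> f s'" "y # zs = east_run s' c' (f s') @ rows R s' f"
    "\<forall>r. R \<le> r \<and> r < s' \<longrightarrow> f (Suc r) \<le> f r"
    using "3.IH"(2)[of s' c'] "3.prems" y by auto
  have "unit_step x y" using "3.prems" by simp
  then consider "s = Suc s'" "c' = c" | "s' = s" "c' = Suc c"
    by (auto simp: x y unit_step_def)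
  then show ?case
  proof cases
    case 1
    define g where "g r = (if r = s then c else f r)" for r
    have "rows R s g = east_run s' c (f s') @ rows R s' g"
      using f(1) 1 by (simp add: rows_Suc g_def)
    also have "rows R s' g = rows R s' f"
      using 1 by (intro rows_cong) (auto simp: g_def)
    finally have "rows R s g = y # zs"
      using f(4) 1 by simp
    then have "x # y # zs = east_run s c (g s) @ rows R s g"
      by (simp add: east_run_def x g_def)
    moreover have "R \<le> s" "g R = d" "c \<le> g s" "\<forall>r. R \<le> r \<and> r < s \<longrightarrow> g (Suc r) \<le> g r"
      using f 1 by (auto simp: less_Suc_eq g_def)
    ultimately show ?thesis by blast
  next
    case 2
    then have "x # y # zs = east_run s c (f s) @ rows R s f"
      using f by (simp add: east_run_Cons[of c] x)
    then show ?thesis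
      using f 2 by (intro exI[of _ f]) auto
  qed
qed simp

lemma is_pipe_columns:
  assumes "is_pipe n k R L" "1 \<le> R" "R \<le> n" "k \<le> n"
  obtains f where "f (n + 1) = k" "\<And>r. r \<le> R \<Longrightarrow> f r = n + 1"
    "\<And>r. R < r \<Longrightarrow> r \<le> n + 1 \<Longrightarrow> f r \<le> n" "\<And>r. r \<le> n \<Longrightarrow> f (Suc r) \<le> f r" "L = pipe_of n R f"
proof -
  obtain M where L: "L = (n + 1, k) # M @ [(R, n + 1)]" and M: "set M \<subseteq> grid n"
    and "successively unit_step L"
    using assms(1) by (auto simp: is_pipe_def)
  then obtain f where f: "f R = n + 1" "k \<le> f (n + 1)"
    "L = east_run (n + 1) k (f (n + 1)) @ rows R (n + 1) f"
    and step: "\<And>r. R \<le> r \<Longrightarrow> r \<le> n \<Longrightarrow> f (Suc r) \<le> f r"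
    using unit_path_columns[of L "n + 1" k R "n + 1"] by auto
  have inner: "x = (n + 1, k) \<or> x = (R, n + 1) \<or> x \<in> grid n" if "x \<in> set L" for x
    using that L M by auto
  have fk: "f (n + 1) = k"
  \<comment> \<open>An eastward step in row n + 1 would visit a box that is neither an end of the
    pipe nor in the grid.\<close>
  proof (rule ccontr)
    assume "f (n + 1) \<noteq> k"
    then have "(n + 1, k + 1) \<in> set L"
      using f by (auto simp: east_run_def)
    from inner[OF this] show False
      using assms by (auto simp: grid_def)
  qed
  have fn: "f r \<le> n" if r: "R < r" "r \<le> n + 1" for r
  proof (cases "r = n + 1")
    case False
    then have "(r, f r) \<in> set L"
      using r step[of r] f(3) by (auto simp: set_rows)
    from inner[OF this] show ?thesis
      using r False by (auto simp: grid_def)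
  qed (use fk assms in simp)
  \<comment> \<open>The path says nothing about rows above its exit row. The value n + 1 there keeps
    the function monotone up to row 0 and exceeds every column of the grid.\<close>
  define g where "g r = (if r \<le> R then n + 1 else f r)" for r
  have "L = pipe_of n R f"
    using f(3) fk by (simp add: pipe_of_def east_run_def)
  also have "\<dots> = pipe_of n R g"
    using assms f(1) by (intro pipe_of_cong) (auto simp: g_def)
  finally have "L = pipe_of n R g" .
  moreover have "g (Suc r) \<le> g r" if "r \<le> n" for r
    using that step[of r] fn[of "Suc r"] by (auto simp: g_def)
  ultimately show thesis
    using that[of g] fk fn assms by (auto simp: g_def)
qed

lemma is_pipe_pipe_of:
  assumes "1 \<le> R" "R \<le> n" "1 \<le> f (n + 1)" "f R = n + 1"
    and le: "\<And>r. R < r \<Longrightarrow> r \<le> n + 1 \<Longrightarrow> f r \<le> n"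
    and step: "\<And>r. R \<le> r \<Longrightarrow> r \<le> n \<Longrightarrow> f (Suc r) \<le> f r"
  shows "is_pipe n (f (n + 1)) R (pipe_of n R f)"
proof -
  define M where "M = rows (Suc R) (n + 1) f @ east_run R (f (Suc R)) n"
  have "f (Suc R) \<le> Suc n"
    using le[of "Suc R"] assms(2) by simp
  then have "pipe_of n R f = (n + 1, f (n + 1)) # M @ [(R, n + 1)]"
    using assms rows_append[of R "Suc R" "n + 1" f]
    by (simp add: pipe_of_def M_def rows_Suc east_run_snoc)
  moreover have "set M \<subseteq> grid n"
  proof
    have pos: "1 \<le> f r" if "R \<le> r" "r \<le> n + 1" for r
      using that(2,1)
    proof (induction r rule: inc_induct)
      case (step m)
      then show ?case using assms(6)[of m] by simp
    qed (use assms in simp)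
    fix x assume x: "x \<in> set M"
    obtain r c where rc: "x = (r, c)" by fastforce
    show "x \<in> grid n"
    proof (cases "r = R")
      case True
      then have "f (Suc R) \<le> c" "c \<le> n"
        using x by (auto simp: rc M_def set_rows east_run_def)
      then show ?thesis
        using True assms pos[of "Suc R"] by (simp add: rc grid_def)
    next
      case False
      then have "R < r" "r \<le> n" "f (Suc r) \<le> c" "c \<le> f r"
        using x by (auto simp: rc M_def set_rows east_run_def)
      then show ?thesis
        using pos[of "Suc r"] le[of r] by (simp add: rc grid_def)
    qed
  qed
  ultimately show ?thesis
    unfolding is_pipe_def using successively_pipe_of[of R n f] step assms(2) by auto
qed

section \<open>Bumpless pipedreams as families of column functions\<close>

definition pipedream_of :: "nat \<Rightarrow> (nat \<Rightarrow> nat) \<Rightarrow> (nat \<Rightarrow> nat \<Rightarrow> nat) \<Rightarrow> pipedream" where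
  "pipedream_of n w X = (\<lambda>k. if k \<in> {1..n} then pipe_of n (inv w k) (X k) else [])"

text \<open>
  \<open>X k r\<close> is the column in which pipe k leaves row r through the top edge, so that in row r
  the pipe occupies the columns from \<open>X k (Suc r)\<close> to \<open>X k r\<close>; from its exit row upwards,
  the value is n + 1. The last assumption says that two pipes cross at most once: their order can
  only change once, from the initial one to the opposite one.
\<close>

locale pipe_columns =
  fixes n :: nat and w :: "nat \<Rightarrow> nat" and X :: "nat \<Rightarrow> nat \<Rightarrow> nat"
  assumes perm: "w permutes {1..n}"
    and start: "k \<in> {1..n} \<Longrightarrow> X k (n + 1) = k"
    and exited: "k \<in> {1..n} \<Longrightarrow> r \<le> inv w k \<Longrightarrow> X k r = n + 1"
    and le_n: "k \<in> {1..n} \<Longrightarrow> inv w k < r \<Longrightarrow> r \<le> n + 1 \<Longrightarrow> X k r \<le> n"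
    and step: "k \<in> {1..n} \<Longrightarrow> r \<le> n \<Longrightarrow> X k (Suc r) \<le> X k r"
    and compat: "k \<in> {1..n} \<Longrightarrow> l \<in> {1..n} \<Longrightarrow> k \<noteq> l \<Longrightarrow> inv w k \<le> r \<Longrightarrow> inv w l \<le> r \<Longrightarrow> r \<le> n \<Longrightarrow>
      X k r < X l (Suc r) \<or> X l r < X k (Suc r) \<or>
      X k (Suc r) < X l (Suc r) \<and> X l (Suc r) = X l r \<and> X l r < X k r \<or>
      X l (Suc r) < X k (Suc r) \<and> X k (Suc r) = X k r \<and> X k r < X l r"
    and inverted_step: "k \<in> {1..n} \<Longrightarrow> l \<in> {1..n} \<Longrightarrow> k < l \<Longrightarrow> inv w k \<le> r \<Longrightarrow> inv w l \<le> r \<Longrightarrow> r \<le> n \<Longrightarrow>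
      X l (Suc r) < X k (Suc r) \<Longrightarrow> X l r < X k r"
begin

section \<open>Order of two pipes from row to row\<close>

lemma inv_mem: "k \<in> {1..n} \<Longrightarrow> 1 \<le> inv w k \<and> inv w k \<le> n"
  using permutes_in_image[OF permutes_inv[OF perm], of k] by auto

lemma w_mem: "r \<in> {1..n} \<Longrightarrow> w r \<in> {1..n}"
  using permutes_in_image[OF perm, of r] by auto

lemma inv_w [simp]: "inv w (w r) = r" and w_inv [simp]: "w (inv w k) = k"
  using permutes_inverses[OF perm] by auto

lemma inv_eq_iff [simp]: "inv w k = inv w l \<longleftrightarrow> k = l"
  by (metis w_inv)

lemma pipe_antimono:
  assumes "k \<in> {1..n}" "s \<le> n + 1" "r \<le> s"
  shows "X k s \<le> X k r"
proof -
  note step' = step[OF assms(1)]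
  show ?thesis
    using assms(3)
  proof (induction r rule: inc_induct)
    case (step m)
    with step'[of m] assms(2) show ?case by simp
  qed simp
qed

lemma pipe_ge_1: "k \<in> {1..n} \<Longrightarrow> r \<le> n + 1 \<Longrightarrow> 1 \<le> X k r"
  using pipe_antimono[of k "n + 1" r] start[of k] by auto

lemma distinct_columns:
  assumes "k \<in> {1..n}" "l \<in> {1..n}" "k \<noteq> l" "inv w k \<le> r" "inv w l \<le> r" "r \<le> n + 1"
  shows "X k r \<noteq> X l r"
proof (cases "r = n + 1")
  case False
  then show ?thesis
    using compat[OF assms(1-5)] step[OF assms(1), of r] step[OF assms(2), of r] assms(6) by linarith
qed (use assms start in simp)

lemma inverted_mono:
  assumes kl: "k \<in> {1..n}" "l \<in> {1..n}" "k < l" "inv w k \<le> s" "inv w l \<le> s"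
    and "r \<le> n + 1" "X l r < X k r" "s \<le> r"
  shows "X l s < X k s"
  using assms(8)
proof (induction s rule: inc_induct)
  case (step m)
  then show ?case
    using inverted_step[OF kl(1-3), of m] kl(4,5) assms(6) by simp
qed (use assms in simp)

lemma le_Suc_n: "k \<in> {1..n} \<Longrightarrow> r \<le> n + 1 \<Longrightarrow> X k r \<le> n + 1"
  using exited[of k r] le_n[of k r] by linarith

text \<open>In its exit row a pipe reaches column n + 1, to the right of all others. If l exited in
  the same row as k or below it, l could not still be to the left of k in that row, as
  \<open>inverted_mono\<close> demands.\<close>

lemma inverted_exit:
  assumes "k \<in> {1..n}" "l \<in> {1..n}" "k < l" "inv w k \<le> r" "inv w l \<le> r" "r \<le> n + 1" "X l r < X k r"
  shows "inv w l < inv w k"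
proof (rule ccontr)
  assume "\<not> inv w l < inv w k"
  then have "X l (inv w l) < X k (inv w l)"
    using inverted_mono[of k l "inv w l" r] assms by simp
  then show False
    using exited[OF assms(2), of "inv w l"] le_Suc_n[OF assms(1), of "inv w l"] inv_mem[OF assms(2)] by simp
qed

lemma pipe_successively: "k \<in> {1..n} \<Longrightarrow> successively unit_step (pipe_of n (inv w k) (X k))"
  using inv_mem[of k] step[of k] by (intro successively_pipe_of) auto

section \<open>Column functions yield bumpless pipedreams\<close>

lemma mem_pipe:
  assumes "k \<in> {1..n}"
  shows "(r, c) \<in> set (pipe_of n (inv w k) (X k)) \<longleftrightarrow>
    r = n + 1 \<and> c = k \<or> inv w k \<le> r \<and> r \<le> n \<and> X k (Suc r) \<le> c \<and> c \<le> X k r"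
  using start[OF assms] by (auto simp: set_pipe_of)

lemma mem_two_pipes:
  assumes "k \<in> {1..n}" "l \<in> {1..n}" "k \<noteq> l"
    and "(r, c) \<in> set (pipe_of n (inv w k) (X k))" "(r, c) \<in> set (pipe_of n (inv w l) (X l))"
  shows "inv w k \<le> r \<and> inv w l \<le> r \<and> r \<le> n \<and>
    (X k (Suc r) < c \<and> c < X k r \<and> c = X l (Suc r) \<and> c = X l r \<or>
     X l (Suc r) < c \<and> c < X l r \<and> c = X k (Suc r) \<and> c = X k r)"
proof -
  have *: "inv w k \<le> r" "inv w l \<le> r" "r \<le> n" "X k (Suc r) \<le> c" "c \<le> X k r" "X l (Suc r) \<le> c" "c \<le> X l r"
    using assms mem_pipe by auto
  with compat[OF assms(1-3) *(1-3)] show ?thesis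
    by linarith
qed

lemma crossing:
  assumes "k \<in> {1..n}" "l \<in> {1..n}" "k \<noteq> l" "inv w k \<le> r" "inv w l \<le> r" "r \<le> n"
    and "X k (Suc r) < c" "c < X k r" "c = X l (Suc r)" "c = X l r"
  shows "horizontal_at (pipe_of n (inv w k) (X k)) (r, c) \<and> vertical_at (pipe_of n (inv w l) (X l)) (r, c)"
proof -
  \<comment> \<open>In its exit row pipe l would leave in column n + 1, and no pipe can be further
    right.\<close>
  have "inv w l \<noteq> r" 
    using assms exited[of l r] le_Suc_n[of k r] by auto
  moreover have "X l r \<le> X l (r - 1)" 
    using step[of l "r - 1"] assms inv_mem[of l] by auto
  \<comment> \<open>For r = n the box below is the start of pipe l, outside the grid.\<close>
  moreover have "r = n \<and> c = l \<or> r < n \<and> X l (Suc (Suc r)) \<le> c"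
    using step[of l "Suc r"] start[of l] assms by (cases "r = n") auto
  ultimately show ?thesis
    using assms inv_mem[of l]
    by (auto simp: horizontal_at_iff vertical_at_iff pipe_successively mem_pipe not_less_eq_eq)
qed

text \<open>In a row with a shared box the pair passes from its initial order to the inverted one.
  It stays inverted from there upwards, so no higher row can have a shared box, and within one row
  the vertical pipe fixes the column.\<close>

lemma no_double_crossing:
  assumes kl: "k \<in> {1..n}" "l \<in> {1..n}" "k < l"
    and "x \<in> set (pipe_of n (inv w k) (X k)) \<inter> set (pipe_of n (inv w l) (X l))"
    and "y \<in> set (pipe_of n (inv w k) (X k)) \<inter> set (pipe_of n (inv w l) (X l))"
  shows "x = y"
proof -
  have *: "inv w k \<le> r \<and> inv w l \<le> r \<and> r \<le> n \<and> X k (Suc r) < X l (Suc r) \<and> X l r < X k r \<and> c = X l r"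
    if "(r, c) \<in> set (pipe_of n (inv w k) (X k)) \<inter> set (pipe_of n (inv w l) (X l))" for r c
    using mem_two_pipes[OF kl(1,2), of r c] inverted_step[OF kl, of r] kl(3) that by auto
  have neq: "\<not> r < s"
    if "(r, c) \<in> set (pipe_of n (inv w k) (X k)) \<inter> set (pipe_of n (inv w l) (X l))"
      "(s, d) \<in> set (pipe_of n (inv w k) (X k)) \<inter> set (pipe_of n (inv w l) (X l))" for r s c d
    using *[OF that(1)] *[OF that(2)] inverted_mono[OF kl, of "Suc r" s] by auto
  obtain r c s d where "x = (r, c)" "y = (s, d)"
    by (metis surj_pair)
  then show ?thesis
    using assms(4,5) neq[of r c s d] neq[of s d r c] *[of r c] *[of s d] by (metis nat_neq_iff)
qed

theorem bumpless_pipedream_of: "bumpless_pipedream n w (pipedream_of n w X)"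
proof -
  have pipe: "is_pipe n k (inv w k) (pipe_of n (inv w k) (X k))" if "k \<in> {1..n}" for k
    using is_pipe_pipe_of[of "inv w k" n "X k"] that inv_mem[OF that] start[OF that] exited[OF that]
      le_n[OF that] step[OF that] by auto
  have cross: "horizontal_at (pipe_of n (inv w k) (X k)) x \<and> vertical_at (pipe_of n (inv w l) (X l)) x \<or>
      vertical_at (pipe_of n (inv w k) (X k)) x \<and> horizontal_at (pipe_of n (inv w l) (X l)) x"
    if "k \<in> {1..n}" "l \<in> {1..n}" "k \<noteq> l"
      "x \<in> set (pipe_of n (inv w k) (X k))" "x \<in> set (pipe_of n (inv w l) (X l))" for k l x
  proof -
    obtain r c where x: "x = (r, c)" by fastforce
    note m = mem_two_pipes[OF that[unfolded x]]
    show ?thesis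
    proof (cases "X k (Suc r) < c")
      case True
      then show ?thesis
        using crossing[OF that(1-3), of r c] m unfolding x by linarith
    next
      case False
      then show ?thesis
        using crossing[OF that(2,1) that(3)[symmetric], of r c] m unfolding x by linarith
    qed
  qed
  have once: "x = y" if "k \<in> {1..n}" "l \<in> {1..n}" "k \<noteq> l"
    "x \<in> set (pipe_of n (inv w k) (X k)) \<inter> set (pipe_of n (inv w l) (X l))"
    "y \<in> set (pipe_of n (inv w k) (X k)) \<inter> set (pipe_of n (inv w l) (X l))" for k l x y
    using that no_double_crossing[of k l x y] no_double_crossing[of l k x y]
    by (metis Int_commute nat_neq_iff)
  have share: "\<not> (sublist [x, y] (pipe_of n (inv w k) (X k)) \<and> sublist [x, y] (pipe_of n (inv w l) (X l)))"
    if "k \<in> {1..n}" "l \<in> {1..n}" "k \<noteq> l" for k l x y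
  proof
    assume *: "sublist [x, y] (pipe_of n (inv w k) (X k)) \<and> sublist [x, y] (pipe_of n (inv w l) (X l))"
    then have "unit_step x y"
      using sublist_unit_step_iff[OF pipe_successively[OF that(1)], of "[x, y]"] by simp
    moreover have "x = y"
      using * by (intro once[OF that]) (auto dest: set_mono_sublist)
    ultimately show False
      by (simp add: unit_step_def)
  qed
  show ?thesis
    unfolding bumpless_pipedream_def pipedream_of_def using pipe cross once share by simp
qed

end

text \<open>The converse translation: \<open>compat\<close> comes from shared boxes being crossings,
  and \<open>inverted_step\<close> from the absence of double crossings.\<close>

theorem bumpless_pipedream_columns:
  assumes w: "w permutes {1..n}" and P: "bumpless_pipedream n w P"
  obtains X where "pipe_columns n w X" "P = pipedream_of n w X"
proof -
  have inv: "1 \<le> inv w k \<and> inv w k \<le> n" if "k \<in> {1..n}" for k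
    using permutes_in_image[OF permutes_inv[OF w], of k] that by auto
  define Q where "Q k f \<longleftrightarrow> f (n + 1) = k \<and> (\<forall>r\<le>inv w k. f r = n + 1) \<and>
      (\<forall>r. inv w k < r \<and> r \<le> n + 1 \<longrightarrow> f r \<le> n) \<and>
      (\<forall>r\<le>n. f (Suc r) \<le> f r) \<and> P k = pipe_of n (inv w k) f" for k f
  have "\<forall>k\<in>{1..n}. \<exists>f. Q k f"
  proof
    fix k assume k: "k \<in> {1..n}"
    then have "is_pipe n k (inv w k) (P k)" "k \<le> n"
      using P by (auto simp: bumpless_pipedream_def)
    with inv[OF k] obtain f where "f (n + 1) = k" "\<And>r. r \<le> inv w k \<Longrightarrow> f r = n + 1"
      "\<And>r. inv w k < r \<Longrightarrow> r \<le> n + 1 \<Longrightarrow> f r \<le> n" "\<And>r. r \<le> n \<Longrightarrow> f (Suc r) \<le> f r"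
      "P k = pipe_of n (inv w k) f"
      using is_pipe_columns by blast
    then have "Q k f" by (simp add: Q_def)
    then show "\<exists>f. Q k f" by blast
  qed
  from bchoice[OF this] obtain X where "\<forall>k\<in>{1..n}. Q k (X k)" ..
  then have X: "\<And>k. k \<in> {1..n} \<Longrightarrow> X k (n + 1) = k"
    "\<And>k r. k \<in> {1..n} \<Longrightarrow> r \<le> inv w k \<Longrightarrow> X k r = n + 1"
    "\<And>k r. k \<in> {1..n} \<Longrightarrow> inv w k < r \<Longrightarrow> r \<le> n + 1 \<Longrightarrow> X k r \<le> n"
    "\<And>k r. k \<in> {1..n} \<Longrightarrow> r \<le> n \<Longrightarrow> X k (Suc r) \<le> X k r"
    "\<And>k. k \<in> {1..n} \<Longrightarrow> P k = pipe_of n (inv w k) (X k)"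
    unfolding Q_def by blast+
  have succ: "successively unit_step (P k)" if "k \<in> {1..n}" for k
    using that inv[OF that] X(4,5) by (auto intro: successively_pipe_of)
  have mem: "(r, c) \<in> set (P k) \<longleftrightarrow>
      r = n + 1 \<and> c = k \<or> inv w k \<le> r \<and> r \<le> n \<and> X k (Suc r) \<le> c \<and> c \<le> X k r"
    if "k \<in> {1..n}" for k r c
    using X(1)[OF that] X(5)[OF that] by (auto simp: set_pipe_of)
  have straight: "X k (Suc r) < c \<and> c < X k r \<and> X l (Suc r) = c \<and> X l r = c"
    if kl: "k \<in> {1..n}" "l \<in> {1..n}" "r \<le> n" and "horizontal_at (P k) (r, c)" "vertical_at (P l) (r, c)"
    for k l r c
  proof -
    have "(r, c - 1) \<in> set (P k)" "1 \<le> c" "(r, c + 1) \<in> set (P k)" "1 \<le> r"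
      "(r + 1, c) \<in> set (P l)" "(r, c) \<in> set (P l)" "(r - 1, c) \<in> set (P l)"
      using that succ by (auto simp: horizontal_at_iff vertical_at_iff)
    then show ?thesis
      using kl X(1)[OF kl(2)] by (auto simp: mem)
  qed
  have compat: "X k r < X l (Suc r) \<or> X l r < X k (Suc r) \<or>
      X k (Suc r) < X l (Suc r) \<and> X l (Suc r) = X l r \<and> X l r < X k r \<or>
      X l (Suc r) < X k (Suc r) \<and> X k (Suc r) = X k r \<and> X k r < X l r"
    if kl: "k \<in> {1..n}" "l \<in> {1..n}" "k \<noteq> l" "inv w k \<le> r" "inv w l \<le> r" "r \<le> n" for k l r
  proof (rule ccontr)
    assume neg: "\<not> ?thesis"
    \<comment> \<open>If \<open>compat\<close> fails, the two runs in row r overlap; the overlap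
      begins at the larger of the two entry columns.\<close>
    define c where "c = max (X k (Suc r)) (X l (Suc r))"
    have "(r, c) \<in> set (P k) \<inter> set (P l)"
      using neg kl X(4)[OF kl(1), of r] X(4)[OF kl(2), of r] by (auto simp: mem c_def max_def)
    then have "horizontal_at (P k) (r, c) \<and> vertical_at (P l) (r, c) \<or>
        vertical_at (P k) (r, c) \<and> horizontal_at (P l) (r, c)"
      using P kl by (auto simp: bumpless_pipedream_def)
    with straight[OF kl(1,2,6), of c] straight[OF kl(2,1,6), of c] neg show False
      by auto
  qed
  have inverted: "X l r < X k r"
    if kl: "k \<in> {1..n}" "l \<in> {1..n}" "k < l" "inv w k \<le> r" "inv w l \<le> r" "r \<le> n"
      and "X l (Suc r) < X k (Suc r)" for k l r
  proof (rule ccontr)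
    assume "\<not> X l r < X k r"
    then have c1: "(r, X k r) \<in> set (P k) \<inter> set (P l)"
      using compat[of k l r] kl that(7) X(4)[OF kl(1), of r] X(4)[OF kl(2), of r]
      by (auto simp: mem)
    \<comment> \<open>The pair is in its initial order at row n + 1 and inverted at row r + 1. With
      s the nearest row below r in the initial order, row s - 1 contains a crossing, different from
      the one in row r.\<close>
    define s where "s = (LEAST s. r < s \<and> s \<le> n + 1 \<and> X k s < X l s)"
    have s: "r < s" "s \<le> n + 1" "X k s < X l s"
      using LeastI[of "\<lambda>s. r < s \<and> s \<le> n + 1 \<and> X k s < X l s" "n + 1"] kl X(1) by (auto simp: s_def)
    have "s \<noteq> Suc r" using s that(7) by auto
    then obtain t where t: "s = Suc t" "r < t" using s by (cases s) auto
    have "\<not> X k t < X l t"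
      using not_less_Least[of t "\<lambda>s. r < s \<and> s \<le> n + 1 \<and> X k s < X l s"] t s by (auto simp: s_def)
    then have "(t, X l t) \<in> set (P k) \<inter> set (P l)"
      using compat[of k l t] kl s t X(4)[OF kl(1), of t] X(4)[OF kl(2), of t] by (auto simp: mem)
    with c1 t P kl show False
      unfolding bumpless_pipedream_def by (metis fst_conv nat_neq_iff)
  qed
  have "pipe_columns n w X"
    by (unfold_locales; (rule w X compat inverted; assumption))
  moreover have "P = pipedream_of n w X"
    using P X(5) by (auto simp: pipedream_of_def bumpless_pipedream_def fun_eq_iff)
  ultimately show thesis ..
qed

section \<open>Permutations\<close>

lemma finite_inversions:
  assumes "u permutes {1..n}"
  shows "finite (inversions u)"
proof (rule finite_subset)
  show "inversions u \<subseteq> {1..n} \<times> {1..n}"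
  proof (clarify)
    fix i j assume "(i, j) \<in> inversions u"
    then have ij: "1 \<le> i" "i < j" "u j < u i" by (auto simp: inversions_def)
    have "j \<le> n"
    proof (rule ccontr)
      assume "\<not> j \<le> n"
      then have "u j = j" by (auto intro: permutes_not_in[OF assms])
      moreover have "u i \<le> i \<or> u i \<le> n"
        using permutes_in_image[OF assms, of i] permutes_not_in[OF assms, of i] by fastforce
      ultimately show False using ij \<open>\<not> j \<le> n\<close> by auto
    qed
    then show "i \<in> {1..n} \<and> j \<in> {1..n}" using ij by auto
  qed
qed simp

text \<open>
  Conjugating pairs of positions by the transposition maps the inversions of one permutation to
  those of the other, except that pairs whose order would be reversed have to be left alone.
\<close>

lemma perm_length_swap_pos:
  assumes u: "u permutes {1..n}" and ab: "1 \<le> a" "a < b" "u a < u b"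
    and gap: "\<And>k. a < k \<Longrightarrow> k < b \<Longrightarrow> \<not> (u a < u k \<and> u k < u b)"
  shows "perm_length (swap_pos u a b) = perm_length u + 1"
proof -
  define v where "v = swap_pos u a b"
  define s where "s = transpose a b"
  define f where "f = (\<lambda>(x, y). if s x < s y then (s x, s y) else (x, y))"
  have v: "v a = u b" "v b = u a" "\<And>x. x \<noteq> a \<Longrightarrow> x \<noteq> b \<Longrightarrow> v x = u x"
    by (auto simp: v_def swap_pos_def)
  have s: "s a = b" "s b = a" "\<And>x. x \<noteq> a \<Longrightarrow> x \<noteq> b \<Longrightarrow> s x = x"
    by (auto simp: s_def)
  have inj: "u x = u y \<longleftrightarrow> x = y" for x y
    using permutes_inj[OF u] by (auto dest: injD)
  have ff: "f (f z) = z" if "z \<in> {(x, y). x < y}" for z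
    using that by (auto simp: f_def s_def)
  have "bij_betw f (inversions u) (inversions v - {(a, b)})"
  proof (rule bij_betw_byWitness[where f' = f])
    show "\<forall>z\<in>inversions u. f (f z) = z" "\<forall>z\<in>inversions v - {(a, b)}. f (f z) = z"
      using ff by (auto simp: inversions_def)
    show "f ` inversions u \<subseteq> inversions v - {(a, b)}"
    proof
      fix z assume "z \<in> f ` inversions u"
      then obtain x y where z: "z = f (x, y)" and xy: "1 \<le> x" "x < y" "u y < u x"
        by (auto simp: inversions_def)
      consider "x = a" "y \<noteq> b" | "x = b" | "x \<noteq> a" "x \<noteq> b" "y = a" | "x \<noteq> a" "x \<noteq> b" "y = b"
        | "x \<noteq> a" "x \<noteq> b" "y \<noteq> a" "y \<noteq> b"
        using xy ab by (cases "x = a"; cases "y = b") auto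
      then show "z \<in> inversions v - {(a, b)}"
        by cases (use xy ab in \<open>simp_all add: z f_def inversions_def s v\<close>)
    qed
    show "f ` (inversions v - {(a, b)}) \<subseteq> inversions u"
    proof
      fix z assume "z \<in> f ` (inversions v - {(a, b)})"
      then obtain x y where z: "z = f (x, y)" and xy: "1 \<le> x" "x < y" "v y < v x" "x = a \<Longrightarrow> y \<noteq> b"
        by (auto simp: inversions_def)
      note g = gap[of x] gap[of y] inj[of x a] inj[of x b] inj[of y a] inj[of y b]
      consider "x = a" "y \<noteq> b" | "x = b" | "x \<noteq> a" "x \<noteq> b" "y = a" | "x \<noteq> a" "x \<noteq> b" "y = b"
        | "x \<noteq> a" "x \<noteq> b" "y \<noteq> a" "y \<noteq> b"
        using xy by blast
      then show "z \<in> inversions u"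
        by cases (use xy ab g in \<open>auto simp: z f_def inversions_def s v\<close>)
    qed
  qed
  then have "card (inversions u) = card (inversions v - {(a, b)})"
    by (rule bij_betw_same_card)
  moreover have "(a, b) \<in> inversions v"
    using ab v by (auto simp: inversions_def)
  moreover have "finite (inversions v)"
    using bij_betw_finite[OF \<open>bij_betw f _ _\<close>] finite_inversions[OF u] by simp
  ultimately show ?thesis
    using card.remove[of "inversions v" "(a, b)"] by (simp add: perm_length_def v_def)
qed

text \<open>The invariant along the path: it bounds the position of the largest entry of a pattern,
  which is what \<open>p_index\<close> maximises. At p = 1 it leaves no pattern at all, since the
  largest entry is preceded by another.\<close>

definition no_132_beyond :: "nat \<Rightarrow> (nat \<Rightarrow> nat) \<Rightarrow> bool" where
  "no_132_beyond p u \<longleftrightarrow> (\<forall>i t j. 1 \<le> i \<and> i < t \<and> t < j \<and> u i < u j \<and> u j < u t \<longrightarrow> t \<le> p)"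

lemma no_132_beyondD: "no_132_beyond p u \<Longrightarrow> 1 \<le> i \<Longrightarrow> i < t \<Longrightarrow> t < j \<Longrightarrow> u i < u j \<Longrightarrow> u j < u t \<Longrightarrow> t \<le> p"
  by (auto simp: no_132_beyond_def)

lemma dominant_no_132_beyond: "no_132_beyond 1 u \<Longrightarrow> dominant u"
  unfolding dominant_def using no_132_beyondD[of 1 u] by (metis le_less_trans less_le_not_le)

lemma no_132_beyond_self:
  assumes "u permutes {1..n}"
  shows "no_132_beyond n u"
  unfolding no_132_beyond_def
proof (intro allI impI, rule ccontr)
  fix i t j assume *: "1 \<le> i \<and> i < t \<and> t < j \<and> u i < u j \<and> u j < u t" "\<not> t \<le> n"
  then have "u t = t" "u j = j" by (auto intro: permutes_not_in[OF assms])
  with * show False by simp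
qed

lemma p_index_eqI:
  assumes "no_132_beyond p u" "1 \<le> i" "i < p" "p < q" "u i < u q" "u q < u p"
  shows "p_index u = p"
  unfolding p_index_def
proof (rule Max_eqI)
  show "finite {t. \<exists>i j. 1 \<le> i \<and> i < t \<and> t < j \<and> u i < u j \<and> u j < u t}"
    using no_132_beyondD[OF assms(1)] by (intro finite_subset[OF _ finite_atMost[of p]]) auto
qed (use assms no_132_beyondD[OF assms(1)] in auto)

text \<open>An admissible j > q would have a value below \<open>u q\<close>, by \<open>max\<close>,
  and together with q would form a 132 pattern whose largest entry is at q, beyond p. This turns the
  maximal position into a maximal value.\<close>

lemma q_index_eqI:
  assumes p: "p_index u = p" and u: "u permutes {1..n}" "no_132_beyond p u"
    and q: "1 \<le> i" "i < p" "p < q" "u i < u q" "u q < u p"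
    and max: "\<And>j. p < j \<Longrightarrow> u j < u p \<Longrightarrow> u j \<le> u q"
  shows "q_index u = q"
  unfolding q_index_def p
proof (rule Max_eqI)
  have *: "j \<le> q" if "p < j" "u j < u p" "1 \<le> i'" "i' < p" "u i' < u j" for j i'
  proof (rule ccontr)
    assume "\<not> j \<le> q"
    then have "u j \<noteq> u q"
      using permutes_inj[OF u(1)] by (auto dest: injD)
    then have "u j < u q" using max[OF that(1,2)] by simp
    then have "q \<le> p"
      using no_132_beyondD[OF u(2), of i' q j] that q \<open>\<not> j \<le> q\<close> by simp
    with q show False by simp
  qed
  show "finite {j. p < j \<and> u j < u p \<and> (\<exists>i\<ge>1. i < p \<and> u i < u j)}"
    using * by (intro finite_subset[OF _ finite_atMost[of q]]) auto
  show "j \<le> q" if "j \<in> {j. p < j \<and> u j < u p \<and> (\<exists>i\<ge>1. i < p \<and> u i < u j)}" for j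
    using that * by auto
  show "q \<in> {j. p < j \<and> u j < u p \<and> (\<exists>i\<ge>1. i < p \<and> u i < u j)}"
    using q by auto
qed

text \<open>Only the entries at i, p and q change. A pattern of the child with largest entry beyond
  p gives one of u with largest entry at the same position: position i can serve as the smallest
  entry if that was at i, p or q, since \<open>u i\<close> is the least of the three values. If the
  largest entry is at q, \<open>max\<close> puts the last entry below \<open>u q\<close>; if the
  last entry is at q, the triple i, t, q is already a pattern of u.\<close>

lemma no_132_beyond_child:
  assumes u: "u permutes {1..n}" "no_132_beyond p u"
    and q: "1 \<le> i" "i < p" "p < q" "u i < u q" "u q < u p"
    and max: "\<And>j. p < j \<Longrightarrow> u j < u p \<Longrightarrow> u j \<le> u q"
  shows "no_132_beyond p (swap_pos (swap_pos u p q) i p)" (is "no_132_beyond p ?v")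
proof -
  have v: "?v i = u q" "?v p = u i" "?v q = u p" "\<And>x. x \<noteq> i \<Longrightarrow> x \<noteq> p \<Longrightarrow> x \<noteq> q \<Longrightarrow> ?v x = u x"
    using q by (auto simp: swap_pos_def transpose_def)
  note D = no_132_beyondD[OF u(2)]
  have "t \<le> p" if abc: "1 \<le> a" "a < t" "t < c" "?v a < ?v c" "?v c < ?v t" for a t c
  proof (rule ccontr)
    assume t: "\<not> t \<le> p"
    show False
    proof (cases "t = q")
      case True
      then have vc: "?v c = u c" and "u c < u p" "u c \<le> u q" "u c \<noteq> u q"
        using v q abc max[of c] permutes_inj[OF u(1)] by (auto dest: injD)
      then have "\<exists>a'. 1 \<le> a' \<and> a' < q \<and> u a' < u c"
        using abc True q v(1,2) v(4)[of a] by (cases "a = i \<or> a = p") auto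
      then show False
        using D[of _ q c] abc(3) True \<open>u c \<le> u q\<close> \<open>u c \<noteq> u q\<close> q(3) by fastforce
    next
      case False
      then have vt: "?v t = u t" using v t q by auto
      show ?thesis
      proof (cases "c = q")
        case True
        then show ?thesis
          using D[of i t q] q abc t vt v(3) by auto
      next
        case c: False
        then have vc: "?v c = u c" using v t q abc by auto
        have "\<exists>a'. 1 \<le> a' \<and> a' < t \<and> u a' < u c"
        proof (cases "a = i \<or> a = p \<or> a = q")
          case True
          then show ?thesis
            using abc vc v q t by (intro exI[of _ i]) auto
        next
          case False
          then show ?thesis using abc vc v by (intro exI[of _ a]) auto
        qed
        then show ?thesis using D[of _ t c] abc vt vc t by auto
      qed
    qed
  qed
  then show ?thesis by (auto simp: no_132_beyond_def)
qed

section \<open>Truncated pipedreams\<close>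

lemma pipedream_of_cong:
  assumes "w permutes {1..n}"
    and "\<And>k r. k \<in> {1..n} \<Longrightarrow> inv w k \<le> r \<Longrightarrow> r \<le> n + 1 \<Longrightarrow> X k r = Y k r"
  shows "pipedream_of n w X = pipedream_of n w Y"
proof
  fix k
  have "k \<in> {1..n} \<Longrightarrow> inv w k \<le> n + 1"
    using permutes_in_image[OF permutes_inv[OF assms(1)], of k] by auto
  then show "pipedream_of n w X k = pipedream_of n w Y k"
    using assms(2) by (auto simp: pipedream_of_def intro!: pipe_of_cong)
qed

lemma rows_const:
  assumes "\<And>r. R \<le> r \<Longrightarrow> r \<le> s \<Longrightarrow> f r = c"
  shows "rows R s f = map (\<lambda>r. (r, c)) (rev [R..<s])"
proof -
  have "rows R s f = rows R s (\<lambda>_. c)"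
    using assms by (rule rows_cong)
  also have "\<dots> = concat (map (\<lambda>r. [(r, c)]) (rev [R..<s]))"
    by (simp add: rows_def east_run_def)
  finally show ?thesis by (simp only: concat_map_singleton)
qed

context pipe_columns
begin

lemma elbow_columns:
  assumes "k \<in> {1..n}" "1 \<le> r" "r \<le> n"
    and "SE_elbow_at (pipe_of n (inv w k) (X k)) (r, c) \<or> NW_elbow_at (pipe_of n (inv w k) (X k)) (r, c)"
  shows "inv w k \<le> r" "X k (Suc r) < X k r" "c = X k (Suc r) \<or> c = X k r"
proof -
  have "inv w k \<le> r \<and> X k (Suc r) < X k r \<and> (c = X k (Suc r) \<or> c = X k r)"
    using assms(4)
  proof
    assume "SE_elbow_at (pipe_of n (inv w k) (X k)) (r, c)"
    then show ?thesis
      using assms(1-3) start[OF assms(1)]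
      by (auto simp: SE_elbow_at_iff pipe_successively mem_pipe)
  next
    assume "NW_elbow_at (pipe_of n (inv w k) (X k)) (r, c)"
    then show ?thesis
      using assms(1-3) by (auto simp: NW_elbow_at_iff pipe_successively mem_pipe)
  qed
  then show "inv w k \<le> r" "X k (Suc r) < X k r" "c = X k (Suc r) \<or> c = X k r"
    by auto
qed

definition cut :: "nat \<Rightarrow> nat \<Rightarrow> nat \<Rightarrow> nat" where
  "cut p c k = (if c \<le> X k (Suc p) then X k p else X k (Suc p))"

definition trunc :: "nat \<Rightarrow> nat \<Rightarrow> nat \<Rightarrow> nat \<Rightarrow> nat" where
  "trunc p c k r = (if r \<le> inv w k then n + 1 else if p < r then X k r else cut p c k)"

lemma trunc_above: "k \<in> {1..n} \<Longrightarrow> p < r \<Longrightarrow> trunc p c k r = X k r"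
  by (simp add: trunc_def exited)

text \<open>The bound on c says that the pipe exiting in row p enters this row at c or further
  right, so that its turn is among those kept by the truncation.\<close>

lemma trunc_at:
  assumes "k \<in> {1..n}" "inv w k \<le> p" "c \<le> X (w p) (Suc p)"
  shows "trunc p c k p = cut p c k"
proof (cases "inv w k = p")
  case True
  then have "w p = k" by auto
  then show ?thesis
    using assms True exited[of k p] by (simp add: trunc_def cut_def)
qed (use assms in \<open>simp add: trunc_def\<close>)

lemma trunc_below: "inv w k < r \<Longrightarrow> r \<le> p \<Longrightarrow> trunc p c k r = cut p c k"
  by (simp add: trunc_def)

lemma trunc_exited: "r \<le> inv w k \<Longrightarrow> trunc p c k r = n + 1"
  by (simp add: trunc_def)

lemma cut_cases:
  assumes "k \<in> {1..n}" "p \<le> n"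
  shows "X k (Suc p) < c \<and> cut p c k = X k (Suc p) \<or>
    c \<le> X k (Suc p) \<and> cut p c k = X k p \<and> X k (Suc p) \<le> X k p"
  using step[OF assms] by (simp add: cut_def)

lemma cut_distinct:
  assumes "k \<in> {1..n}" "l \<in> {1..n}" "k \<noteq> l" "inv w k \<le> p" "inv w l \<le> p" "p \<le> n"
  shows "cut p c k \<noteq> cut p c l"
  using cut_cases[OF assms(1,6), of c] cut_cases[OF assms(2,6), of c]
    distinct_columns[OF assms(1-3), of p] distinct_columns[OF assms(1-3), of "Suc p"] assms(4-6)
  by auto

lemma cut_le_n:
  assumes "k \<in> {1..n}" "inv w k < p" "p \<le> n"
  shows "cut p c k \<le> n"
  using le_n[OF assms(1), of p] le_n[OF assms(1), of "Suc p"] assms by (simp add: cut_def)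

text \<open>Whichever of the two pipes keep their turns, an inversion after the cut comes from one
  in X, at the lower or at the upper edge of row p.\<close>

lemma cut_inverted:
  assumes kl: "k \<in> {1..n}" "l \<in> {1..n}" "k < l" "inv w k \<le> p" "inv w l \<le> p"
    and "p \<le> n" "cut p c l < cut p c k"
  shows "inv w l < inv w k"
proof -
  have "X l (Suc p) < X k (Suc p) \<or> X l p < X k p"
    using cut_cases[OF kl(1) assms(6), of c] cut_cases[OF kl(2) assms(6), of c] assms(7) by linarith
  then show ?thesis
    using inverted_exit[OF kl(1-3), of p] inverted_exit[OF kl(1-3), of "Suc p"] assms by auto
qed

text \<open>Above row p the order changes only when a pipe turns east to its exit and crosses the
  vertical pipes on its right. An already inverted pair does not meet again there: by
  \<open>cut_inverted\<close> its right pipe exits in the lower row.\<close>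

lemma pipe_columns_trunc:
  assumes p: "p \<le> n" and c: "c \<le> X (w p) (Suc p)"
  shows "pipe_columns n w (trunc p c)"
proof
  show "trunc p c k (n + 1) = k" if "k \<in> {1..n}" for k
    using that p start by (simp add: trunc_above)
  show "trunc p c k r = n + 1" if "k \<in> {1..n}" "r \<le> inv w k" for k r
    using that by (simp add: trunc_exited)
  show le: "trunc p c k r \<le> n" if "k \<in> {1..n}" "inv w k < r" "r \<le> n + 1" for k r
    using that p le_n[of k r] cut_le_n[of k p c] by (simp add: trunc_def)
  show "trunc p c k (Suc r) \<le> trunc p c k r" if k: "k \<in> {1..n}" "r \<le> n" for k r
  proof -
    consider "r \<le> inv w k" | "inv w k < r" "p < r" | "inv w k < r" "r = p" | "inv w k < r" "r < p"
      by linarith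
    then show ?thesis
    proof cases
      case 1
      then show ?thesis using le[of k "Suc r"] k by (cases "Suc r \<le> inv w k") (auto simp: trunc_exited)
    next
      case 3
      then show ?thesis
        using cut_cases[OF k(1) p, of c] k c by (auto simp: trunc_at trunc_above)
    qed (use k step in \<open>simp_all add: trunc_def\<close>)
  qed
next
  fix k l r assume kl: "k \<in> {1..n}" "l \<in> {1..n}" "k \<noteq> l" "inv w k \<le> r" "inv w l \<le> r" "r \<le> n"
  let ?Y = "trunc p c"
  consider "p < r" | "r = p" | "r < p" by linarith
  then show "?Y k r < ?Y l (Suc r) \<or> ?Y l r < ?Y k (Suc r) \<or>
      ?Y k (Suc r) < ?Y l (Suc r) \<and> ?Y l (Suc r) = ?Y l r \<and> ?Y l r < ?Y k r \<or>
      ?Y l (Suc r) < ?Y k (Suc r) \<and> ?Y k (Suc r) = ?Y k r \<and> ?Y k r < ?Y l r"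
  proof cases
    case 1
    then show ?thesis using compat[OF kl] kl by (simp add: trunc_above)
  next
    case 2
    then show ?thesis
      using compat[OF kl] kl c cut_cases[OF kl(1) p, of c] cut_cases[OF kl(2) p, of c]
        distinct_columns[OF kl(1-3), of "Suc p"]
      by (simp add: trunc_above trunc_at) linarith
  next
    case 3
    then have "?Y k (Suc r) = cut p c k" "?Y l (Suc r) = cut p c l"
      "?Y k r = (if inv w k = r then n + 1 else cut p c k)"
      "?Y l r = (if inv w l = r then n + 1 else cut p c l)"
      "cut p c k \<noteq> cut p c l" "cut p c k \<le> n" "cut p c l \<le> n"
      using kl p cut_distinct[OF kl(1-3), of p c] cut_le_n[OF kl(1), of p c] cut_le_n[OF kl(2), of p c]
      by (auto simp: trunc_def)
    moreover have "\<not> (inv w k = r \<and> inv w l = r)"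
      using kl(3) by (metis w_inv)
    ultimately show ?thesis by auto
  qed
next
  fix k l r assume kl: "k \<in> {1..n}" "l \<in> {1..n}" "k < l" "inv w k \<le> r" "inv w l \<le> r" "r \<le> n"
    and inverted: "trunc p c l (Suc r) < trunc p c k (Suc r)"
  consider "p < r" | "r = p" | "r < p" by linarith
  then show "trunc p c l r < trunc p c k r"
  proof cases
    case 1
    then show ?thesis using inverted_step[OF kl] kl inverted by (simp add: trunc_above)
  next
    case 2
    then have "X l (Suc p) < X k (Suc p)" "X l p < X k p"
      using inverted_step[OF kl] inverted kl by (auto simp: trunc_above)
    then show ?thesis
      using 2 kl c cut_cases[OF kl(1) p, of c] cut_cases[OF kl(2) p, of c]
      by (simp add: trunc_at) linarith
  next
    case 3
    then have "cut p c l < cut p c k"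
      using inverted kl by (simp add: trunc_below)
    moreover have "inv w l < inv w k"
      using cut_inverted[OF kl(1-3), of p c] calculation 3 kl p by simp
    ultimately show ?thesis
      using 3 kl p cut_le_n[OF kl(2), of p c] by (auto simp: trunc_def)
  qed
qed (rule perm)

text \<open>In X the box (p, \<open>X l p\<close>) is an NW elbow of pipe l, so no other pipe enters
  it from below; and the pipes whose turns are kept stay at or beyond c.\<close>

lemma cut_ne_top:
  assumes "l \<in> {1..n}" "inv w l < p" "p \<le> n" "X l (Suc p) < X l p" "X l p < c"
    and "k \<in> {1..n}" "inv w k \<le> p"
  shows "cut p c k \<noteq> X l p"
proof (cases "k = l")
  case False
  then show ?thesis
    using compat[of k l p] cut_cases[of k p c] step[of k p] assms by auto
qed (use assms in \<open>simp add: cut_def\<close>)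

text \<open>Moving c left to the next SE elbow adds exactly one turn, that of pipe l. Before, l
  climbs column b up to its exit row i and turns at (i, b); afterwards it moves along row p from b
  to d and climbs there. These are the two ways around the rectangle with corners (i, b) and (p,
  d).\<close>

lemma droop_trunc:
  assumes p: "p \<le> n" and c: "c \<le> X (w p) (Suc p)"
    and l: "l \<in> {1..n}" "inv w l < p" "X l (Suc p) < X l p" "X l p < c"
    and next_elbow: "\<And>k. k \<in> {1..n} \<Longrightarrow> inv w k \<le> p \<Longrightarrow> X l (Suc p) < X k (Suc p) \<Longrightarrow> X k (Suc p) < c \<Longrightarrow>
      X k p = X k (Suc p)"
    and gap: "\<And>r. inv w l < r \<Longrightarrow> r < p \<Longrightarrow> \<not> (X l (Suc p) < cut p c (w r) \<and> cut p c (w r) < X l p)"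
  shows "droop n w (pipedream_of n w (trunc p c)) (inv w l, X l (Suc p)) (p, X l p)
    (pipedream_of n w (trunc p (X l (Suc p))))"
proof -
  define i b d where "i = inv w l" and "b = X l (Suc p)" and "d = X l p"
  note ibd = i_def b_def d_def
  have lt: "i < p" "b < d" "d < c" and i1: "1 \<le> i" and d: "d \<le> n" and b1: "1 \<le> b"
    using l p inv_mem[of l] le_n[of l p] pipe_ge_1[of l "Suc p"] by (auto simp: ibd)
  interpret T: pipe_columns n w "trunc p c"
    using p c by (rule pipe_columns_trunc)
  interpret T': pipe_columns n w "trunc p b"
    using p c lt by (intro pipe_columns_trunc) auto
  let ?P = "pipedream_of n w (trunc p c)" and ?P' = "pipedream_of n w (trunc p b)"
  have P: "?P k = pipe_of n (inv w k) (trunc p c k)" if "k \<in> {1..n}" for k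
    using that by (simp add: pipedream_of_def)
  have cutl: "cut p c l = b" "cut p b l = d"
    using lt by (auto simp: cut_def ibd)
  have ne_d: "cut p c k \<noteq> d" if "k \<in> {1..n}" "inv w k \<le> p" for k
    using cut_ne_top[of l p c k] l p that by (simp add: ibd)
  have empty: "(p, d) \<in> empty_boxes n ?P"
  proof -
    have "(p, d) \<notin> set (?P k)" if k: "k \<in> {1..n}" for k
    proof
      assume "(p, d) \<in> set (?P k)"
      then have *: "inv w k \<le> p" "X k (Suc p) \<le> d" "d \<le> cut p c k"
        using k p c by (auto simp: P T.mem_pipe trunc_above trunc_at)
      then have "cut p c k = d"
        using lt by (auto simp: cut_def)
      with ne_d[OF k *(1)] show False by simp
    qed
    then show ?thesis
      using lt i1 b1 d p by (auto simp: empty_boxes_def grid_def)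
  qed
  define xs where "xs = (n + 1, l) # rows (Suc p) (n + 1) (X l)"
  define ys where "ys = east_run i (d + 1) (n + 1)"
  have pipe_eq: "?P l = xs @ (north_run p i b @ east_run i (b + 1) d) @ ys"
  proof -
    have "rows i (n + 1) (trunc p c l) =
        rows (Suc p) (n + 1) (trunc p c l) @ rows (Suc i) (Suc p) (trunc p c l) @ rows i (Suc i) (trunc p c l)"
      using lt p rows_append[of i "Suc p" "n + 1" "trunc p c l"]
        rows_append[of i "Suc i" "Suc p" "trunc p c l"] by simp
    also have "rows (Suc p) (n + 1) (trunc p c l) = rows (Suc p) (n + 1) (X l)"
      using l by (intro rows_cong) (simp add: trunc_above)
    also have "rows (Suc i) (Suc p) (trunc p c l) = map (\<lambda>r. (r, b)) (rev [Suc i..<Suc p])"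
    proof (rule rows_const)
      fix r assume "Suc i \<le> r" "r \<le> Suc p"
      then show "trunc p c l r = b"
        using l cutl by (cases "r = Suc p") (auto simp: trunc_above trunc_below ibd)
    qed
    also have "rows i (Suc i) (trunc p c l) = (i, b) # east_run i (b + 1) d @ ys"
      using lt d l cutl east_run_append[of "b + 1" d "n + 1" i]
      by (simp add: rows_Suc trunc_exited trunc_below i_def ys_def east_run_Cons)
    finally have "rows i (n + 1) (trunc p c l) =
        rows (Suc p) (n + 1) (X l) @ map (\<lambda>r. (r, b)) (rev [Suc i..<Suc p]) @ (i, b) # east_run i (b + 1) d @ ys" .
    moreover have "north_run p i b = map (\<lambda>r. (r, b)) (rev [Suc i..<Suc p]) @ [(i, b)]"
      using lt by (simp add: north_run_def upt_rec[of i])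
    ultimately show ?thesis
      using l T.start[of l] by (simp add: P pipe_of_def xs_def i_def)
  qed
  have pipe_eq': "?P' l = xs @ (east_run p b d @ north_run (p - 1) i d) @ ys"
  proof -
    have "rows i (n + 1) (trunc p b l) =
        rows (Suc p) (n + 1) (trunc p b l) @ rows p (Suc p) (trunc p b l) @
        rows (Suc i) p (trunc p b l) @ rows i (Suc i) (trunc p b l)"
      using lt p rows_append[of i "Suc p" "n + 1" "trunc p b l"] rows_append[of i p "Suc p" "trunc p b l"]
        rows_append[of i "Suc i" p "trunc p b l"] by simp
    also have "rows (Suc p) (n + 1) (trunc p b l) = rows (Suc p) (n + 1) (X l)"
      using l by (intro rows_cong) (simp add: trunc_above)
    also have "rows p (Suc p) (trunc p b l) = east_run p b d"
      using l lt cutl by (simp add: rows_Suc trunc_above trunc_below i_def b_def)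
    also have "rows (Suc i) p (trunc p b l) = map (\<lambda>r. (r, d)) (rev [Suc i..<p])"
      using cutl by (intro rows_const) (simp add: trunc_below i_def)
    also have "rows i (Suc i) (trunc p b l) = (i, d) # ys"
      using lt d l cutl
      by (simp add: rows_Suc trunc_exited trunc_below i_def ys_def east_run_Cons[of d])
    finally have "rows i (n + 1) (trunc p b l) = rows (Suc p) (n + 1) (X l) @ east_run p b d @
        map (\<lambda>r. (r, d)) (rev [Suc i..<p]) @ (i, d) # ys" .
    moreover have "north_run (p - 1) i d = map (\<lambda>r. (r, d)) (rev [Suc i..<p]) @ [(i, d)]"
      using lt by (simp add: north_run_def upt_rec[of i])
    ultimately show ?thesis
      using l T'.start[of l] by (simp add: pipedream_of_def pipe_of_def xs_def i_def)
  qed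
  have upd: "?P' = ?P(l := xs @ (east_run p b d @ north_run (p - 1) i d) @ ys)"
  proof
    fix k
    show "?P' k = (?P(l := xs @ (east_run p b d @ north_run (p - 1) i d) @ ys)) k"
    proof (cases "k = l \<or> k \<notin> {1..n}")
      case True
      then show ?thesis using pipe_eq' l by (auto simp: pipedream_of_def)
    next
      case False
      \<comment> \<open>A pipe entering row p strictly between b and c goes straight in X, so
        lowering c to b does not change it.\<close>
      have "trunc p b k r = trunc p c k r" if "inv w k \<le> r" for r
      proof (cases "inv w k < r \<and> r \<le> p")
        case True
        then have "cut p b k = cut p c k"
          using False lt p next_elbow[of k] distinct_columns[of k l "Suc p"] l
          by (auto simp: cut_def ibd)
        then show ?thesis using True by (simp add: trunc_below)
      qed (use that False in \<open>auto simp: trunc_def\<close>)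
      then show ?thesis
        using False inv_mem[of k] by (auto simp: pipedream_of_def intro!: pipe_of_cong)
    qed
  qed
  have SE: "SE_elbow_at (?P l) (i, b)"
  proof -
    have "trunc p c l (Suc i) = b" "trunc p c l i = n + 1" "trunc p c l (Suc (Suc i)) \<le> trunc p c l (Suc i)"
      using lt p cutl l T.step[of l "Suc i"] by (auto simp: trunc_below trunc_exited i_def)
    then show ?thesis
      using l lt p d i_def by (simp add: P SE_elbow_at_iff T.pipe_successively T.mem_pipe)
  qed
  \<comment> \<open>In row p only pipes entering at c or further right turn, which is beyond d.
    Above row p the only elbows of the truncation in columns up to d are those where a pipe turns to
    its exit; \<open>gap\<close> and the distinctness of the columns exclude them.\<close>
  have no_elbow: "\<not> SE_elbow_at (?P k) x \<and> \<not> NW_elbow_at (?P k) x"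
    if k: "k \<in> {1..n}" and x: "x \<in> {i..p} \<times> {b..d} - {(i, b)}" for k x
  proof (rule ccontr)
    obtain r e where x_eq: "x = (r, e)" by fastforce
    have re: "i \<le> r" "r \<le> p" "b \<le> e" "e \<le> d" "r = i \<Longrightarrow> e \<noteq> b" using x x_eq by auto
    assume "\<not> ?thesis"
    then have "SE_elbow_at (pipe_of n (inv w k) (trunc p c k)) (r, e) \<or>
        NW_elbow_at (pipe_of n (inv w k) (trunc p c k)) (r, e)"
      using k by (auto simp: P x_eq)
    from T.elbow_columns[OF k _ _ this] re i1 p
    have el: "inv w k \<le> r" "trunc p c k (Suc r) < trunc p c k r"
      "e = trunc p c k (Suc r) \<or> e = trunc p c k r" by auto
    show False
    proof (cases "r = p")
      case True
      then show ?thesis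
        using el k c re lt by (auto simp: trunc_above trunc_at cut_def split: if_splits)
    next
      case False
      then have r: "inv w k = r" "e = cut p c k"
        using el re d by (auto simp: trunc_def split: if_splits)
      then have wr: "w r = k" by auto
      show ?thesis
      proof (cases "r = i")
        case True
        then show ?thesis using r re cutl wr by (auto simp: i_def)
      next
        case ri: False
        then have "k \<noteq> l" using r by (auto simp: i_def)
        then show ?thesis
          using gap[of r] ne_d[OF k] cut_distinct[OF k l(1), of p c] cutl r re wr ri l(2) p False
          by (auto simp: ibd)
      qed
    qed
  qed
  have "bumpless_pipedream n w ?P'"
    by (rule T'.bumpless_pipedream_of)
  then have "droop n w ?P (i, b) (p, d) ?P'"
    unfolding droop_def prod.case using lt empty SE pipe_eq upd no_elbow l(1) by blast
  then show ?thesis by (simp add: ibd)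
qed

end

section \<open>The path to a given EG-pipedream\<close>

lemma EG_tree_LS_tree: "(ws, P) \<in> EG_tree n w \<Longrightarrow> ws \<in> LS_tree w"
  by (cases rule: EG_tree.cases) (auto intro: LS_tree.root)

lemma LS_tree_snocD: "ws @ [v] \<in> LS_tree w \<Longrightarrow> ws = [] \<or> v \<in> LS_children (last ws)"
  by (cases rule: LS_tree.cases) auto

lemma LS_tree_nonempty: "ws \<in> LS_tree w \<Longrightarrow> ws \<noteq> []"
  by (cases rule: LS_tree.cases) auto

lemma EG_leafI:
  assumes "(ws, P) \<in> EG_tree n w" "dominant (last ws)"
  shows "EG_leaf n w (ws, P)"
  using assms LS_tree_snocD[of ws _ w] LS_tree_nonempty[OF EG_tree_LS_tree[OF assms(1)]]
  by (auto simp: EG_leaf_def LS_children_def)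

text \<open>Left-justification is stated through its contrapositive for visited boxes: whatever lies
  to the right of a visited box in its row is visited too.\<close>

locale EG_columns = pipe_columns +
  assumes left_justified: "k \<in> {1..n} \<Longrightarrow> inv w k \<le> r \<Longrightarrow> r \<le> n \<Longrightarrow> X k (Suc r) \<le> d \<Longrightarrow> d \<le> X k r \<Longrightarrow>
    d \<le> c \<Longrightarrow> c \<le> n \<Longrightarrow> \<exists>l\<in>{1..n}. inv w l \<le> r \<and> X l (Suc r) \<le> c \<and> c \<le> X l r"
begin

text \<open>
  The node ws of the tree, with permutation u, is labelled by the pipedream that agrees with X
  below row p and, in row p, on the pipes entering at column c or further right; c is an SE elbow
  of X in row p.
\<close>

definition reached :: "nat \<Rightarrow> nat \<Rightarrow> (nat \<Rightarrow> nat) list \<Rightarrow> (nat \<Rightarrow> nat) \<Rightarrow> bool" where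
  "reached p c ws u \<longleftrightarrow> (ws, pipedream_of n w (trunc p c)) \<in> EG_tree n w \<and> last ws = u \<and>
     u permutes {1..n} \<and> u p = c \<and> c \<le> X (w p) (Suc p) \<and>
     (\<exists>m\<in>{1..n}. inv w m \<le> p \<and> X m (Suc p) = c \<and> c < X m p) \<and>
     (\<forall>r\<in>{1..<p}. u r = cut p c (w r)) \<and> no_132_beyond p u"

text \<open>The hypothesis on k makes l the pipe of the rightmost SE elbow of X to the left of c in
  row p.\<close>

lemma reached_droop:
  assumes p: "1 \<le> p" "p \<le> n" and re: "reached p c ws u"
    and l: "l \<in> {1..n}" "inv w l \<le> p" "X l (Suc p) < c" "X l (Suc p) < X l p"
    and next_elbow: "\<And>k. k \<in> {1..n} \<Longrightarrow> inv w k \<le> p \<Longrightarrow> X l (Suc p) < X k (Suc p) \<Longrightarrow> X k (Suc p) < c \<Longrightarrow>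
      X k p = X k (Suc p)"
  shows "\<exists>v. reached p (X l (Suc p)) (ws @ [v]) v"
proof -
  define i b d where "i = inv w l" and "b = X l (Suc p)" and "d = X l p"
  note ibd = i_def b_def d_def
  have tree: "(ws, pipedream_of n w (trunc p c)) \<in> EG_tree n w" and last: "last ws = u"
    and u: "u permutes {1..n}" "u p = c" "no_132_beyond p u"
    and c: "c \<le> X (w p) (Suc p)" and u_cut: "\<And>r. 1 \<le> r \<Longrightarrow> r < p \<Longrightarrow> u r = cut p c (w r)"
    using re by (auto simp: reached_def)
  obtain m where m: "m \<in> {1..n}" "inv w m \<le> p" "X m (Suc p) = c" "c < X m p"
    using re by (auto simp: reached_def)
  have inj: "u x = u y \<longleftrightarrow> x = y" for x y
    using permutes_inj[OF u(1)] by (auto dest: injD)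
  have not_p: "inv w k < p" if "k \<in> {1..n}" "inv w k \<le> p" "X k (Suc p) < c" for k
    using that c by (metis le_neq_implies_less not_le w_inv)
  have i: "1 \<le> i" "i < p" "w i = l"
    using inv_mem[OF l(1)] not_p[OF l(1-3)] by (auto simp: ibd)
  have d: "1 \<le> d" "d \<le> n"
    using pipe_ge_1[OF l(1), of p] le_n[OF l(1), of p] p i by (auto simp: ibd)
  \<comment> \<open>Pipe m has an SE elbow at (p, c), so the run of l, which starts to the left of
    c, cannot reach that box.\<close>
  have lt: "b < d" "d < c"
    using l compat[of l m p] m p by (auto simp: ibd)
  have cn: "c \<le> n"
    using le_n[OF m(1), of "Suc p"] m p by simp
  have ne_d: "cut p c k \<noteq> d" if "k \<in> {1..n}" "inv w k \<le> p" for k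
    using cut_ne_top[of l p c k] l p that i lt by (simp add: ibd)
  have ui: "u i = b"
    using u_cut[of i] i l by (simp add: cut_def b_def)
  \<comment> \<open>Such a pipe \<open>w r\<close> would be crossed by l in row p of X. If l is the
    smaller label, the pair is inverted above row p and \<open>w r\<close> exits above l, against i
    < r; if l is the larger, the pair was already inverted below row p and would cross
    twice.\<close>
  have gap: "\<not> (b < cut p c (w r) \<and> cut p c (w r) < d)" if r: "i < r" "r < p" for r
  proof
    assume *: "b < cut p c (w r) \<and> cut p c (w r) < d"
    have k: "w r \<in> {1..n}"
      using w_mem[of r] r p i by simp
    have "w r \<noteq> l"
      using r(1) by (metis i_def inv_w less_irrefl)
    note k = k this
    have "X (w r) (Suc p) < c" "cut p c (w r) = X (w r) (Suc p)"
      using cut_cases[OF k(1) p(2), of c] * lt by auto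
    then have cross: "X l (Suc p) < X (w r) (Suc p)" "X (w r) p < X l p"
      using * next_elbow[OF k(1)] r by (auto simp: ibd)
    show False
    proof (cases "l < w r")
      case True
      then show False
        using inverted_exit[of "w r" l p] inverted_exit[of l "w r" p] cross k l r p i
        by (auto simp: ibd)
    next
      case False
      then have "X l p < X (w r) p"
        using inverted_step[of "w r" l p] cross k l r p i by (auto simp: ibd)
      with cross show False by simp
    qed
  qed
  \<comment> \<open>The position is defined by its value, as u is not known beyond p; d occurs
    neither before p, by \<open>ne_d\<close>, nor at p.\<close>
  define q where "q = inv u d"
  have uq: "u q = d"
    by (simp add: q_def permutes_inverses[OF u(1)])
  have "q \<in> {1..n}"
    using permutes_in_image[OF permutes_inv[OF u(1)], of d] d by (auto simp: q_def)
  moreover have "\<not> q < p"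
    using u_cut[of q] uq ne_d[of "w q"] w_mem[of q] calculation by auto
  moreover have "q \<noteq> p" using uq u(2) lt by auto
  ultimately have q: "p < q" "q \<le> n" by auto
  \<comment> \<open>For a value strictly between d and c, left-justification gives a pipe k of X in
    that column of row p. If k is straight, its exit row is the position of the value, which is then
    before p. If it turns, it enters at or before b by the choice of l, and its run would overlap
    that of l.\<close>
  have max: "u j \<le> u q" if j: "p < j" "u j < u p" for j
  proof (rule ccontr)
    assume "\<not> u j \<le> u q"
    then have uj: "d < u j" "u j < c" using j u uq by auto
    obtain k where k: "k \<in> {1..n}" "inv w k \<le> p" "X k (Suc p) \<le> u j" "u j \<le> X k p"
      using left_justified[OF l(1,2) p(2), of d "u j"] uj cn lt by (auto simp: ibd)
    then have kp: "inv w k < p" "X k (Suc p) < c" using not_p[of k] uj by auto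
    then have uk: "u (inv w k) = X k (Suc p)"
      using u_cut[of "inv w k"] inv_mem[OF k(1)] by (simp add: cut_def)
    show False
    proof (cases "X k (Suc p) = X k p")
      case True
      then have "inv w k = j" using uk k inj[of "inv w k" j] by simp
      with kp j show False by simp
    next
      case False
      then have "X k (Suc p) \<le> b"
        using next_elbow[OF k(1,2)] kp by (auto simp: b_def not_less[symmetric])
      moreover have "k \<noteq> l" using k uj by (auto simp: ibd)
      ultimately show False
        using compat[of k l p] distinct_columns[of k l "Suc p"] k l p uj by (auto simp: ibd)
    qed
  qed
  have p_index: "p_index u = p"
    using p_index_eqI[of p u i q] u i q ui uq lt by simp
  have q_index: "q_index u = q"
    using q_index_eqI[OF p_index u(1,3) i(1,2) q(1)] max ui uq u(2) lt by simp
  define z v where "z = swap_pos u p q" and "v = swap_pos z i p"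
  have z: "z p = d" "\<And>r. r < p \<Longrightarrow> z r = u r" "z permutes {1..n}"
    using uq q p u(1) by (auto simp: z_def swap_pos_def transpose_def intro!: permutes_compose permutes_swap_id)
  have v: "v i = d" "v p = b" "\<And>r. r < p \<Longrightarrow> r \<noteq> i \<Longrightarrow> v r = u r" "v permutes {1..n}"
    using z i p ui by (auto simp: v_def swap_pos_def transpose_def intro!: permutes_compose permutes_swap_id)
  have "perm_length (swap_pos z i p) = perm_length z + 1"
  proof (rule perm_length_swap_pos[OF z(3)])
    show "\<not> (z i < z k \<and> z k < z p)" if "i < k" "k < p" for k
      using gap[OF that] u_cut[of k] z that i ui by simp
  qed (use i z ui lt in auto)
  then have I: "i \<in> I_set z p"
    using i by (simp add: I_set_def)
  have "\<not> dominant u"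
    unfolding dominant_def using i q ui uq u(2) lt by (metis not_less)
  then have "v \<in> LS_children (last ws)"
    using in_Phi.swap[OF I] by (simp add: LS_children_def last p_index q_index Phi_def z_def v_def)
  then have LS: "ws @ [v] \<in> LS_tree w"
    using EG_tree_LS_tree[OF tree] by (intro LS_tree.child)
  have "droop n w (pipedream_of n w (trunc p c)) (i, u i) (p, u q) (pipedream_of n w (trunc p b))"
    using droop_trunc[OF p(2) c l(1) _ l(4) _ next_elbow] gap i lt by (simp add: ibd ui[unfolded ibd] uq[unfolded ibd])
  then have "(ws @ [v], pipedream_of n w (trunc p b)) \<in> EG_tree n w"
    using EG_tree.child[OF tree last[symmetric] p_index[symmetric] q_index[symmetric] I[unfolded z_def]
        v_def[unfolded z_def] LS] by simp
  moreover have "b \<le> X (w p) (Suc p)" using c lt by simp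
  moreover have "\<exists>m\<in>{1..n}. inv w m \<le> p \<and> X m (Suc p) = b \<and> b < X m p"
    using l by (auto simp: b_def)
  moreover have "v r = cut p b (w r)" if r: "r \<in> {1..<p}" for r
  proof (cases "r = i")
    case True
    then show ?thesis using v i by (simp add: cut_def ibd)
  next
    case False
    then have "w r \<noteq> l" by (auto simp: i_def)
    moreover have "w r \<in> {1..n}" using w_mem[of r] r p by simp
    ultimately have "cut p b (w r) = cut p c (w r)"
      using next_elbow[of "w r"] distinct_columns[of "w r" l "Suc p"] l r p lt
      by (auto simp: cut_def b_def)
    then show ?thesis using v(3)[of r] u_cut[of r] False r by simp
  qed
  moreover have "no_132_beyond p v"
    unfolding v_def z_def using no_132_beyond_child[OF u(1,3) i(1,2) q(1)] max ui uq u(2) lt by simp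
  ultimately have "reached p b (ws @ [v]) v"
    using v by (simp add: reached_def)
  then show ?thesis by (auto simp: b_def)
qed

text \<open>Once row p + 1 has no further turns, only the description of the node changes: the same
  truncation is read as one in row p, with the exit elbow of pipe \<open>w p\<close> in the role of
  c.\<close>

lemma reached_next_row:
  assumes p: "1 \<le> p" "Suc p \<le> n" and re: "reached (Suc p) c ws u"
    and straight: "\<And>k. k \<in> {1..n} \<Longrightarrow> inv w k \<le> Suc p \<Longrightarrow> X k (Suc (Suc p)) < c \<Longrightarrow>
      X k (Suc p) = X k (Suc (Suc p))"
  shows "reached p (u p) ws u"
proof -
  have tree: "(ws, pipedream_of n w (trunc (Suc p) c)) \<in> EG_tree n w" and last: "last ws = u"
    and u: "u permutes {1..n}" "u (Suc p) = c" "no_132_beyond (Suc p) u"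
    and c: "c \<le> X (w (Suc p)) (Suc (Suc p))" and "\<And>r. 1 \<le> r \<Longrightarrow> r < Suc p \<Longrightarrow> u r = cut (Suc p) c (w r)"
    using re by (auto simp: reached_def)
  then have ur: "u r = X (w r) (Suc p)" if "1 \<le> r" "r \<le> p" for r
    using that straight[of "w r"] w_mem[of r] p by (auto simp: cut_def)
  obtain m where m: "m \<in> {1..n}" "inv w m \<le> Suc p" "X m (Suc (Suc p)) = c"
    using re by (auto simp: reached_def)
  have cut_c: "cut (Suc p) c k = X k (Suc p)" if "k \<in> {1..n}" "inv w k \<le> Suc p" for k
    using straight[OF that] by (simp add: cut_def)
  have wp: "w p \<in> {1..n}" using w_mem[of p] p by simp
  \<comment> \<open>Pipe \<open>w p\<close> occupies row p from column \<open>u p\<close> to the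
    border, so a pipe entering further right has to cross it vertically.\<close>
  have past: "X k p = X k (Suc p)" if k: "k \<in> {1..n}" "inv w k < p" "u p \<le> X k (Suc p)" for k
  proof -
    have "k \<noteq> w p" using k(2) by auto
    then show ?thesis
      using compat[OF k(1) wp, of p] exited[OF wp, of p] k p ur[of p] le_n[OF k(1), of p]
        step[OF k(1), of p] by auto
  qed
  have cut_p: "cut p (u p) k = X k (Suc p)" if "k \<in> {1..n}" "inv w k < p" for k
    using past[OF that] by (simp add: cut_def)
  have "pipedream_of n w (trunc p (u p)) = pipedream_of n w (trunc (Suc p) c)"
  proof (rule pipedream_of_cong[OF perm])
    fix k r assume k: "k \<in> {1..n}" "inv w k \<le> r"
    show "trunc p (u p) k r = trunc (Suc p) c k r"
    proof (cases "inv w k < r \<and> r \<le> Suc p")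
      case True
      then show ?thesis using k cut_p[of k] cut_c[of k] by (cases "r = Suc p") (auto simp: trunc_def)
    qed (use k in \<open>auto simp: trunc_def\<close>)
  qed
  moreover have "\<exists>m\<in>{1..n}. inv w m \<le> p \<and> X m (Suc p) = u p \<and> u p < X m p"
    using ur[of p] wp exited[OF wp, of p] le_n[OF wp, of "Suc p"] p by (intro bexI[of _ "w p"]) auto
  moreover have "u r = cut p (u p) (w r)" if "r \<in> {1..<p}" for r
    using ur[of r] cut_p[of "w r"] w_mem[of r] that p by simp
  \<comment> \<open>Only a largest entry at p + 1 is left to exclude. Pipe \<open>w i\<close> visits
    row p + 1 in column \<open>u i\<close>, so by left-justification some pipe k visits column
    \<open>u j\<close>. It enters left of c, hence is straight, and its exit row is the position j
    of the value; but this row is not beyond p + 1.\<close>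
  moreover have "no_132_beyond p u"
    unfolding no_132_beyond_def
  proof (intro allI impI, rule ccontr)
    fix i t j assume *: "1 \<le> i \<and> i < t \<and> t < j \<and> u i < u j \<and> u j < u t" "\<not> t \<le> p"
    then have t: "t = Suc p" using no_132_beyondD[OF u(3), of i t j] by auto
    have wi: "w i \<in> {1..n}" using w_mem[of i] * t p by simp
    have ui: "u i = X (w i) (Suc p)" using ur[of i] * t by simp
    then have "X (w i) (Suc (Suc p)) = u i"
      using cut_c[OF wi] straight[OF wi] step[OF wi, of "Suc p"] * t p u(2) 
        distinct_columns[of "w i" m "Suc (Suc p)"]
      by (auto simp: cut_def)
    moreover have "c \<le> n" using le_n[OF m(1), of "Suc (Suc p)"] m p by simp
    ultimately obtain k where k: "k \<in> {1..n}" "inv w k \<le> Suc p" "X k (Suc (Suc p)) \<le> u j" "u j \<le> X k (Suc p)"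
      using left_justified[OF wi, of "Suc p" "u i" "u j"] ui * t p u(2) by auto
    then have kc: "X k (Suc (Suc p)) < c" using * t u(2) by simp
    then have "X k (Suc p) = u j" using straight[OF k(1,2)] k by simp
    moreover have "inv w k \<noteq> Suc p" using kc c by (metis not_le w_inv)
    ultimately have "u (inv w k) = u j"
      using ur[of "inv w k"] k inv_mem[OF k(1)] by simp
    then have "inv w k = j" using permutes_inj[OF u(1)] by (auto dest: injD)
    then show False using k * t by simp
  qed
  ultimately show ?thesis
    using tree last u ur[of p] p by (simp add: reached_def)
qed

text \<open>The outer induction goes up the rows, the inner one is on c, which each droop moves
  strictly to the left.\<close>

lemma leaf_exists:
  assumes "1 \<le> p" "p \<le> n" "reached p c ws u"
  shows "\<exists>ws. EG_leaf n w (ws, pipedream_of n w X)"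
  using assms
proof (induction p arbitrary: c ws u)
  case (Suc p)
  from Suc.prems(3) show ?case
  proof (induction c arbitrary: ws u rule: less_induct)
    case (less c)
    define S where "S = {k \<in> {1..n}. inv w k \<le> Suc p \<and> X k (Suc (Suc p)) < c \<and> X k (Suc (Suc p)) < X k (Suc p)}"
    have St: "X k (Suc p) = X k (Suc (Suc p))"
      if "k \<in> {1..n}" "inv w k \<le> Suc p" "X k (Suc (Suc p)) < c" "k \<notin> S" for k
      using that step[of k "Suc p"] Suc.prems(2) by (auto simp: S_def)
    show ?case
    proof (cases "S = {}")
      case True
      then have straight: "X k (Suc p) = X k (Suc (Suc p))"
        if "k \<in> {1..n}" "inv w k \<le> Suc p" "X k (Suc (Suc p)) < c" for k
        using St that by simp
      show ?thesis
      proof (cases "p = 0")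
        case False
        then show ?thesis
          using Suc.IH[OF _ _ reached_next_row[OF _ Suc.prems(2) less.prems straight]] Suc.prems(2) by simp
      next
        case True
        have "pipedream_of n w (trunc (Suc p) c) = pipedream_of n w X"
        proof (rule pipedream_of_cong[OF perm])
          fix k r assume "k \<in> {1..n}" "inv w k \<le> r"
          then show "trunc (Suc p) c k r = X k r"
            using True inv_mem[of k] exited[of k r] by (auto simp: trunc_def)
        qed
        moreover have "dominant (last ws)"
          using less.prems True dominant_no_132_beyond by (simp add: reached_def)
        ultimately have "EG_leaf n w (ws, pipedream_of n w X)"
          using less.prems by (intro EG_leafI) (simp_all add: reached_def)
        then show ?thesis ..
      qed
    next
      case False
      \<comment> \<open>The droops in a row are taken from right to left: the next turn to add is
        the rightmost one remaining.\<close>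
      define M where "M = Max ((\<lambda>k. X k (Suc (Suc p))) ` S)"
      have fin: "finite S" by (simp add: S_def)
      then have "M \<in> (\<lambda>k. X k (Suc (Suc p))) ` S"
        unfolding M_def using False by (intro Max_in) auto
      then obtain l where l: "l \<in> S" "X l (Suc (Suc p)) = M" by auto
      have le_M: "X k (Suc (Suc p)) \<le> M" if "k \<in> S" for k
        unfolding M_def using fin that by (intro Max_ge) auto
      have "X k (Suc p) = X k (Suc (Suc p))"
        if "k \<in> {1..n}" "inv w k \<le> Suc p" "X l (Suc (Suc p)) < X k (Suc (Suc p))" "X k (Suc (Suc p)) < c" for k
      proof (rule St[OF that(1,2,4)])
        show "k \<notin> S"
          using le_M[of k] that(3) l by auto
      qed
      then obtain v where "reached (Suc p) (X l (Suc (Suc p))) (ws @ [v]) v"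
        using reached_droop[OF _ Suc.prems(2) less.prems, of l] l(1) by (auto simp: S_def)
      then show ?thesis
        using less.IH[of "X l (Suc (Suc p))"] l(1) by (auto simp: S_def)
    qed
  qed
qed simp

text \<open>In row n the run of pipe \<open>w n\<close> from column \<open>w n\<close> to the border
  forces all pipes further right to be straight. So the truncation at that column has no turns
  besides the exits, as in the Rothe pipedream.\<close>

lemma reached_root:
  assumes "1 \<le> n"
  shows "reached n (w n) [w] w"
proof -
  have wn: "w n \<in> {1..n}" using w_mem[of n] assms by simp
  have past: "X k n = k" if k: "k \<in> {1..n}" "inv w k < n" "w n \<le> k" for k
  proof -
    have "k \<noteq> w n" using k(2) by auto
    then show ?thesis
      using compat[OF k(1) wn, of n] exited[OF wn, of n] k assms start[OF k(1)] start[OF wn]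
        le_n[OF k(1), of n] step[OF k(1), of n] by auto
  qed
  have cut_n: "cut n (w n) k = k" if "k \<in> {1..n}" "inv w k < n" for k
    using past[OF that] start[OF that(1)] by (simp add: cut_def)
  have "pipedream_of n w (trunc n (w n)) = Rothe_pipedream n w"
  proof
    fix k
    show "pipedream_of n w (trunc n (w n)) k = Rothe_pipedream n w k"
    proof (cases "k \<in> {1..n}")
      case True
      have inv: "1 \<le> inv w k" "inv w k \<le> n" using inv_mem[OF True] by auto
      have val: "trunc n (w n) k r = k" if "inv w k < r" "r \<le> Suc n" for r
        using that True start[OF True] cut_n[OF True] by (cases "r = Suc n") (auto simp: trunc_def)
      have "rows (inv w k) (n + 1) (trunc n (w n) k) =
          rows (Suc (inv w k)) (n + 1) (trunc n (w n) k) @ rows (inv w k) (Suc (inv w k)) (trunc n (w n) k)"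
        using inv by (intro rows_append) auto
      also have "rows (Suc (inv w k)) (n + 1) (trunc n (w n) k) = map (\<lambda>r. (r, k)) (rev [Suc (inv w k)..<n + 1])"
        using val by (intro rows_const) auto
      also have "rows (inv w k) (Suc (inv w k)) (trunc n (w n) k) = (inv w k, k) # east_run (inv w k) (k + 1) (n + 1)"
        using val[of "Suc (inv w k)"] inv True by (simp add: rows_Suc trunc_exited east_run_Cons)
      finally show ?thesis
        using True val[of "Suc n"] inv
        by (simp add: pipedream_of_def pipe_of_def Rothe_pipedream_def north_run_def upt_rec[of "inv w k"])
    qed (simp_all add: pipedream_of_def Rothe_pipedream_def del: atLeastAtMost_iff)
  qed
  moreover have "\<exists>m\<in>{1..n}. inv w m \<le> n \<and> X m (Suc n) = w n \<and> w n < X m n"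
    using start[OF wn] exited[OF wn, of n] wn by (intro bexI[of _ "w n"]) auto
  moreover have "w r = cut n (w n) (w r)" if "r \<in> {1..<n}" for r
    using cut_n[of "w r"] w_mem[of r] that by simp
  ultimately show ?thesis
    using perm no_132_beyond_self[OF perm] start[OF wn] EG_tree.root[of w n] by (simp add: reached_def)
qed

end

theorem theorem5p3:
  fixes n :: nat and w :: "nat \<Rightarrow> nat" and P :: pipedream
  assumes "w permutes {1..n}"
    and "EG_pipedream n w P"
  shows "\<exists>ws. EG_leaf n w (ws, P)"
proof -
  have "bumpless_pipedream n w P"
    using assms(2) by (simp add: EG_pipedream_def)
  with assms(1) obtain X where X: "pipe_columns n w X" and P: "P = pipedream_of n w X"
    by (rule bumpless_pipedream_columns)
  interpret pipe_columns n w X by (rule X)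
  obtain lam where lam: "empty_boxes n P = {(r, c). 1 \<le> r \<and> 1 \<le> c \<and> c \<le> lam r}"
    using assms(2) by (auto simp: EG_pipedream_def)
  have empty: "(r, c) \<in> empty_boxes n P \<longleftrightarrow> r \<in> {1..n} \<and> c \<in> {1..n} \<and>
      (\<forall>k\<in>{1..n}. inv w k \<le> r \<longrightarrow> \<not> (X k (Suc r) \<le> c \<and> c \<le> X k r))" for r c
    by (auto simp: empty_boxes_def grid_def P pipedream_of_def mem_pipe)
  interpret EG_columns n w X
  proof
    fix k r d c
    assume k: "k \<in> {1..n}" "inv w k \<le> r" "r \<le> n" "X k (Suc r) \<le> d" "d \<le> X k r" and dc: "d \<le> c" "c \<le> n"
    have r: "1 \<le> r" and d: "1 \<le> d"
      using inv_mem[OF k(1)] pipe_ge_1[OF k(1), of "Suc r"] k by auto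
    have "(r, d) \<notin> empty_boxes n P"
      using k by (auto simp: empty)
    then have "(r, c) \<notin> empty_boxes n P"
      using r d dc by (auto simp: lam)
    then show "\<exists>l\<in>{1..n}. inv w l \<le> r \<and> X l (Suc r) \<le> c \<and> c \<le> X l r"
      using r d dc k by (auto simp: empty)
  qed
  show ?thesis
  \<comment> \<open>Without a row n to start from, the root is already the leaf.\<close>
  proof (cases "n = 0")
    case True
    then have "P = Rothe_pipedream n w" "dominant w"
      using assms(1) by (auto simp: P pipedream_of_def Rothe_pipedream_def dominant_def)
    then show ?thesis
      using EG_leafI[of "[w]" P n w] EG_tree.root[of w n] by auto
  next
    case False
    then show ?thesis
      using leaf_exists[OF _ _ reached_root] by (simp add: P)
  qed
qed

end
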